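(* A random matching $\mathbb{RM}_n$ contains, asymptotically almost surely, stacks and waves of size at least $\frac{1-o(1)}{e\sqrt2}\sqrt n$ each, as well as lines of size at least $\frac18\sqrt n$. That is, there is a sequence $\varepsilon_n\to 0$ such that the probability that $\mathbb{RM}_n$ contains a stack of size at least $\frac{1-\varepsilon_n}{e\sqrt2}\sqrt n$, a wave of size at least $\frac{1-\varepsilon_n}{e\sqrt2}\sqrt n$, and a line of size at least $\frac18\sqrt n$ tends to $1$ as $n\to\infty$.
   Context: An ordered matching of size $n$ is a graph on a linearly ordered vertex set of $2n$ vertices consisting of $n$ pairwise vertex-disjoint edges. $\mathbb{RM}_n$ denotes a random ordered matching of size $n$, selected uniformly at random from all $(2n)!/(n!2^n)$ matchings of size $n$ on the vertex set $\{1,\dots,2n\}$ with its natural order. The size of a matching is its number of edges; a sub-matching is a subset of the edges, its vertices inheriting the linear order. A matching with $k$ edges $\{a_i,b_i\}$, $a_i<b_i$, $i=1,\dots,k$, numbered so that $a_1<\cdots<a_k$, is called: a line if $a_1<b_1<a_2<b_2<\cdots<a_k<b_k$; a stack if $a_1<a_2<\cdots<a_k<b_k<b_{k-1}<\cdots<b_1$; a wave if $a_1<a_2<\cdots<a_k<b_1<b_2<\cdots<b_k$. A matching contains a line (stack, wave) if some sub-matching of it is a line (stack, wave). "Asymptotically almost surely" (a.a.s.) means with probability tending to $1$ as $n\to\infty$. *)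

theory Defs
  imports "HOL-Probability.Probability"
begin

definition ordered_matchings :: "nat \<Rightarrow> nat set set set" where
  "ordered_matchings n =
     {M. (\<forall>e\<in>M. e \<subseteq> {1..2 * n} \<and> card e = 2) \<and> pairwise disjnt M \<and> card M = n}"

definition RM :: "nat \<Rightarrow> nat set set pmf" where
  "RM n = pmf_of_set (ordered_matchings n)"

text \<open>In the next three definitions the left and right ends of the \<open>k\<close> edges are
  \<open>a 1, \<dots>, a k\<close> and \<open>b 1, \<dots>, b k\<close>; the list is the required strictly increasing
  order of all \<open>2 k\<close> vertices. In particular the vertices are distinct, so the set of edges
  is a matching and has cardinality \<open>k\<close>.\<close>

definition is_line :: "'a::linorder set set \<Rightarrow> bool" where
  "is_line M \<longleftrightarrow> (\<exists>k a b. M = (\<lambda>i::nat. {a i, b i}) ` {1..k} \<and>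
     sorted_wrt (<) (concat (map (\<lambda>i. [a i, b i]) [1..<Suc k])))"

definition is_stack :: "'a::linorder set set \<Rightarrow> bool" where
  "is_stack M \<longleftrightarrow> (\<exists>k a b. M = (\<lambda>i::nat. {a i, b i}) ` {1..k} \<and>
     sorted_wrt (<) (map a [1..<Suc k] @ rev (map b [1..<Suc k])))"

definition is_wave :: "'a::linorder set set \<Rightarrow> bool" where
  "is_wave M \<longleftrightarrow> (\<exists>k a b. M = (\<lambda>i::nat. {a i, b i}) ` {1..k} \<and>
     sorted_wrt (<) (map a [1..<Suc k] @ map b [1..<Suc k]))"

text \<open>The uniform distribution is taken over a finite nonempty set, as \<open>pmf_of_set\<close> requires.\<close>

lemma finite_ordered_matchings: "finite (ordered_matchings n)"
proof (rule finite_subset)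
  show "ordered_matchings n \<subseteq> Pow (Pow {1..2 * n})"
    by (auto simp: ordered_matchings_def)
qed simp

lemma ordered_matchings_nonempty: "ordered_matchings n \<noteq> {}"
proof -
  let ?f = "\<lambda>i::nat. {2 * i - 1, 2 * i}"
  have inj: "inj_on ?f {1..n}"
  proof (rule inj_onI)
    fix i j assume "i \<in> {1..n}" "j \<in> {1..n}" "?f i = ?f j"
    then show "i = j" by (auto simp: doubleton_eq_iff)
  qed
  have "pairwise disjnt (?f ` {1..n})"
    unfolding pairwise_def disjnt_def by (auto; presburger)
  moreover have "card (?f i) = 2" if "i \<in> {1..n}" for i
    using that by (auto simp: card_insert_if)
  ultimately have "?f ` {1..n} \<in> ordered_matchings n"
    using card_image[OF inj] by (auto simp: ordered_matchings_def)
  then show ?thesis by blast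
qed

lemma set_pmf_RM: "set_pmf (RM n) = ordered_matchings n"
  by (simp add: RM_def finite_ordered_matchings ordered_matchings_nonempty set_pmf_of_set)

end

theory Submission
  imports Defs "HOL-Real_Asymp.Real_Asymp"
begin

text \<open>Stacks and waves: a stack or a wave is determined by its set of vertices, so the expected
  number of stacks (or of waves) of size \<open>k\<close> is at most
  \<open>(2n choose 2k) / ((2n-1)(2n-3)\<dots>(2n-2k+1)) \<le> (e\<^sup>2 n / (2 k\<^sup>2))\<^sup>k\<close>, and a.a.s. there is none
  with \<open>k \<ge> (1 + \<delta>) e sqrt (n / 2)\<close>, where \<open>\<delta> = n powr (-1/4)\<close>. By Chebyshev's inequality a.a.s.
  at least \<open>n / 2 - n powr (3/4)\<close> edges join the two halves of the vertex set. These edges form a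
  permutation whose increasing and decreasing subsequences are waves and stacks, so by the
  Erdos--Szekeres argument an upper bound on one kind gives a lower bound on the other.

  Lines: expose the edges at the first \<open>s = \<lfloor>2 sqrt n\<rfloor>\<close> vertices. They contain an edge among
  themselves with probability at least \<open>1/2\<close>, and such an edge extends every line of the remaining
  matching, which is uniform on at least \<open>2n - 2s\<close> vertices to the right. Iterating \<open>n div s\<close> times
  bounds the expectation of \<open>2\<close> to the power minus the longest line by \<open>(3/4) ^ (n div s)\<close>,
  and Markov's inequality finishes the proof.\<close>

section \<open>Counting perfect matchings\<close>

text \<open>The vertex set is arbitrary because exposing edges leaves a matching on the remaining
  vertices, which need not form an interval. The condition \<open>\<Union>M = V\<close> plays the
  role of the prescribed number of edges.\<close>

definition perfect_matchings :: "'a set \<Rightarrow> 'a set set set" where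
  "perfect_matchings V = {M. (\<forall>e\<in>M. card e = 2) \<and> pairwise disjnt M \<and> \<Union>M = V}"

text \<open>The double factorial \<open>(2 * n - 1)!!\<close>, which counts the perfect matchings on
  \<open>2 * n\<close> vertices.\<close>

definition odd_fact :: "nat \<Rightarrow> nat" where
  "odd_fact n = (\<Prod>i<n. 2 * i + 1)"

lemma odd_fact_0 [simp]: "odd_fact 0 = 1"
  and odd_fact_Suc: "odd_fact (Suc n) = (2 * n + 1) * odd_fact n"
  by (simp_all add: odd_fact_def)

lemma odd_fact_pos: "odd_fact n > 0"
  by (induction n) (simp_all add: odd_fact_Suc)

lemma odd_fact_fact: "odd_fact n * (fact n * 2 ^ n) = fact (2 * n)"
proof (induction n)
  case (Suc n)
  have "odd_fact (Suc n) * (fact (Suc n) * 2 ^ Suc n) =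
      2 * Suc n * ((2 * n + 1) * (odd_fact n * (fact n * 2 ^ n)))"
    by (simp only: odd_fact_Suc fact_Suc power_Suc of_nat_id mult_ac)
  also have "\<dots> = fact (2 * Suc n)" unfolding Suc by simp
  finally show ?case .
qed simp

lemma finite_perfect_matchings: "finite V \<Longrightarrow> finite (perfect_matchings V)"
  by (rule finite_subset[of _ "Pow (Pow V)"]) (auto simp: perfect_matchings_def)

lemma finite_perfect_matching: "finite V \<Longrightarrow> M \<in> perfect_matchings V \<Longrightarrow> finite M"
  by (auto simp: perfect_matchings_def intro: finite_UnionD)

lemma card_Union_perfect_matching:
  assumes "finite V" "M \<in> perfect_matchings V"
  shows "card V = 2 * card M"
proof -
  have "card (\<Union>M) = (\<Sum>e\<in>M. card e)"
    using assms by (intro card_Union_disjoint)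
      (auto simp: perfect_matchings_def intro: finite_subset)
  then show ?thesis using assms by (simp add: perfect_matchings_def)
qed

lemma perfect_matchings_empty [simp]: "perfect_matchings {} = {{}}"
proof -
  have "M = {}" if "M \<in> perfect_matchings ({} :: 'a set)" for M
    using card_Union_perfect_matching[OF _ that] finite_perfect_matching[OF _ that] by simp
  moreover have "{} \<in> perfect_matchings ({} :: 'a set)"
    by (simp add: perfect_matchings_def)
  ultimately show ?thesis by blast
qed

lemma perfect_matchings_disjoint_Un:
  assumes "A \<in> perfect_matchings V" "B \<in> perfect_matchings W" "V \<inter> W = {}"
  shows "A \<union> B \<in> perfect_matchings (V \<union> W)"
proof -
  have "disjnt e f" if "e \<in> A" "f \<in> B" for e f
    using assms that unfolding perfect_matchings_def disjnt_def by blast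
  then have "pairwise disjnt (A \<union> B)"
    using assms unfolding perfect_matchings_def pairwise_def mem_Collect_eq
    by (metis UnE disjnt_sym)
  then show ?thesis using assms by (auto simp: perfect_matchings_def)
qed

lemma perfect_matchings_subset:
  assumes "M \<in> perfect_matchings V" "F \<subseteq> M"
  shows "F \<in> perfect_matchings (\<Union>F)"
  using assms pairwise_subset[of disjnt M F] by (auto simp: perfect_matchings_def)

lemma perfect_matchings_Diff:
  assumes "M \<in> perfect_matchings V" "F \<subseteq> M"
  shows "M - F \<in> perfect_matchings (V - \<Union>F)"
proof -
  have pw: "pairwise disjnt M" and V: "\<Union>M = V"
    using assms by (auto simp: perfect_matchings_def)
  have "disjnt e f" if "e \<in> M - F" "f \<in> F" for e f
    using pairwiseD[OF pw, of e f] assms(2) that by blast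
  then have "\<Union>(M - F) = V - \<Union>F"
    using V assms(2) by (auto simp: disjnt_iff)
  then show ?thesis
    using perfect_matchings_subset[OF assms(1), of "M - F"] by simp
qed

lemma singleton_perfect_matchings: "v \<noteq> w \<Longrightarrow> {{v, w}} \<in> perfect_matchings {v, w}"
  by (auto simp: perfect_matchings_def)

lemma perfect_matching_disjoint:
  assumes "M \<in> perfect_matchings (V - U)" "F \<in> perfect_matchings U"
  shows "M \<inter> F = {}"
proof (rule ccontr)
  assume "M \<inter> F \<noteq> {}"
  then obtain e where "e \<in> M" "e \<in> F" by blast
  with assms have "card e = 2" "e \<subseteq> V - U" "e \<subseteq> U"
    by (auto simp: perfect_matchings_def)
  then show False by (metis Diff_disjoint card_2_iff' disjoint_iff subset_iff)
qed

text \<open>Removing \<open>F\<close> is a bijection onto the matchings of the remaining vertices,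
  with adding \<open>F\<close> as its inverse. Thus a uniform matching conditioned on containing
  \<open>F\<close> is uniform outside \<open>U\<close>.\<close>

lemma card_perfect_matchings_supset:
  assumes "F \<in> perfect_matchings U" "U \<subseteq> V"
  shows "card {M \<in> perfect_matchings V. F \<subseteq> M} = card (perfect_matchings (V - U))"
proof -
  have U: "\<Union>F = U" using assms by (simp add: perfect_matchings_def)
  have "bij_betw (\<lambda>M. M - F) {M \<in> perfect_matchings V. F \<subseteq> M} (perfect_matchings (V - U))"
  proof (rule bij_betw_byWitness[where f' = "\<lambda>M. M \<union> F"])
    show "(\<lambda>M. M - F) ` {M \<in> perfect_matchings V. F \<subseteq> M} \<subseteq> perfect_matchings (V - U)"
      using perfect_matchings_Diff U by blast
    show "(\<lambda>M. M \<union> F) ` perfect_matchings (V - U) \<subseteq> {M \<in> perfect_matchings V. F \<subseteq> M}"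
      using perfect_matchings_disjoint_Un[OF _ assms(1), of _ "V - U"] assms(2)
      by (auto simp: Un_absorb2 Diff_disjoint Int_commute)
    show "\<forall>M\<in>perfect_matchings (V - U). M \<union> F - F = M"
      using perfect_matching_disjoint[OF _ assms(1)] by blast
  qed auto
  then show ?thesis by (rule bij_betw_same_card)
qed

text \<open>Conditioning on the partner \<open>w\<close> of a fixed vertex \<open>v\<close>: every
  matching arises exactly once from one such edge and a matching of the other vertices. This
  recursion drives the count and both exposure arguments for lines.\<close>

lemma sum_perfect_matchings:
  fixes f :: "'a set set \<Rightarrow> 'b::comm_monoid_add"
  assumes "finite V" "v \<in> V"
  shows "(\<Sum>M\<in>perfect_matchings V. f M) =
    (\<Sum>w\<in>V - {v}. \<Sum>M\<in>perfect_matchings (V - {v, w}). f (insert {v, w} M))"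
proof -
  let ?P = "\<lambda>w. insert {v, w} ` perfect_matchings (V - {v, w})"
  \<comment> \<open>A matching that leaves \<open>v\<close> uncovered has no edge at
    \<open>v\<close>. Hence inserting an edge at \<open>v\<close> is injective, and different
    partners give different matchings.\<close>
  have nin: "{v, w} \<notin> M" if "M \<in> perfect_matchings (V - {v, u})" for M w u
    using that by (auto simp: perfect_matchings_def)
  have eq: "perfect_matchings V = (\<Union>w\<in>V - {v}. ?P w)"
  proof (intro equalityI subsetI)
    fix M assume M: "M \<in> perfect_matchings V"
    then obtain e where e: "e \<in> M" "v \<in> e" "card e = 2"
      using assms by (auto simp: perfect_matchings_def)
    then obtain w where w: "e = {v, w}" "w \<noteq> v"
      by (metis card_2_iff doubleton_eq_iff insert_iff singleton_iff)
    have "w \<in> V" using M e w by (auto simp: perfect_matchings_def)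
    moreover have "M - {{v, w}} \<in> perfect_matchings (V - {v, w})"
      using perfect_matchings_Diff[OF M, of "{{v, w}}"] e w by simp
    moreover have "M = insert {v, w} (M - {{v, w}})" using e w by blast
    ultimately show "M \<in> (\<Union>w\<in>V - {v}. ?P w)" using w by blast
  next
    fix M assume "M \<in> (\<Union>w\<in>V - {v}. ?P w)"
    then obtain w M' where w: "w \<in> V" "w \<noteq> v" "M' \<in> perfect_matchings (V - {v, w})"
      "M = insert {v, w} M'" by blast
    have "(V - {v, w}) \<union> {v, w} = V" using w assms by blast
    then show "M \<in> perfect_matchings V"
      using perfect_matchings_disjoint_Un[OF w(3) singleton_perfect_matchings[of v w]] w by auto
  qed
  have disj: "?P w \<inter> ?P u = {}" if "w \<noteq> u" for w u
  proof (rule ccontr)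
    assume "?P w \<inter> ?P u \<noteq> {}"
    then obtain M M' where "M \<in> perfect_matchings (V - {v, w})" 
      "M' \<in> perfect_matchings (V - {v, u})" "insert {v, w} M = insert {v, u} M'" by blast
    moreover from this have "{v, w} \<in> insert {v, u} M'" by blast
    ultimately show False using nin that by (metis doubleton_eq_iff insert_iff)
  qed
  have inj: "inj_on (insert {v, w}) (perfect_matchings (V - {v, w}))" for w
    by (rule inj_onI) (metis insert_ident nin)
  have "(\<Sum>M\<in>perfect_matchings V. f M) = (\<Sum>w\<in>V - {v}. \<Sum>M\<in>?P w. f M)"
    unfolding eq using assms disj
    by (intro sum.UNION_disjoint) (auto intro!: finite_imageI finite_perfect_matchings)
  also have "\<dots> = (\<Sum>w\<in>V - {v}. \<Sum>M\<in>perfect_matchings (V - {v, w}). f (insert {v, w} M))"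
    by (simp add: sum.reindex[OF inj])
  finally show ?thesis .
qed

lemma card_perfect_matchings:
  assumes "finite V" "card V = 2 * m"
  shows "card (perfect_matchings V) = odd_fact m"
  using assms
proof (induction m arbitrary: V)
  case (Suc m)
  then obtain v where v: "v \<in> V" by fastforce
  have "card (perfect_matchings V) = (\<Sum>M\<in>perfect_matchings V. 1)" by simp
  also have "\<dots> = (\<Sum>w\<in>V - {v}. card (perfect_matchings (V - {v, w})))"
    using sum_perfect_matchings[OF \<open>finite V\<close> v, of "\<lambda>_. 1 :: nat"] by simp
  also have "\<dots> = (\<Sum>w\<in>V - {v}. odd_fact m)"
  proof (rule sum.cong)
    fix w assume "w \<in> V - {v}"
    then show "card (perfect_matchings (V - {v, w})) = odd_fact m"
      using Suc v by (intro Suc.IH) (auto simp: card_Diff_subset)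
  qed simp
  also have "\<dots> = odd_fact (Suc m)"
    using Suc v by (simp add: odd_fact_Suc)
  finally show ?case .
qed simp

text \<open>By counting: \<open>n\<close> disjoint edges cover \<open>2 * n\<close> vertices, so
  inside \<open>{1..2 * n}\<close> they cover everything; conversely, covering everything takes
  \<open>n\<close> edges.\<close>

lemma ordered_matchings_eq: "ordered_matchings n = perfect_matchings {1..2 * n}"
proof (intro equalityI subsetI)
  fix M assume M: "M \<in> ordered_matchings n"
  have "card (\<Union>M) = (\<Sum>e\<in>M. card e)"
    using M by (intro card_Union_disjoint)
      (auto simp: ordered_matchings_def intro: finite_subset)
  also have "\<dots> = card {1..2 * n}" using M by (simp add: ordered_matchings_def)
  finally have "\<Union>M = {1..2 * n}"
    using M by (intro card_subset_eq) (auto simp: ordered_matchings_def)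
  then show "M \<in> perfect_matchings {1..2 * n}"
    using M by (auto simp: ordered_matchings_def perfect_matchings_def)
next
  fix M assume M: "M \<in> perfect_matchings {1..2 * n}"
  then have "card M = n" using card_Union_perfect_matching[OF _ M] by simp
  then show "M \<in> ordered_matchings n"
    using M by (auto simp: ordered_matchings_def perfect_matchings_def)
qed

lemma prob_RM:
  "measure_pmf.prob (RM n) A =
    real (card {M \<in> perfect_matchings {1..2 * n}. M \<in> A}) / real (odd_fact n)"
proof -
  have "perfect_matchings {1..2 * n} \<inter> A = {M \<in> perfect_matchings {1..2 * n}. M \<in> A}" by blast
  then show ?thesis
    using finite_ordered_matchings[of n] ordered_matchings_nonempty[of n]
    by (simp add: RM_def measure_pmf_of_set ordered_matchings_eq
        card_perfect_matchings del: One_nat_def)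
qed

section \<open>Lines\<close>

text \<open>The maximum ranges over a nonempty set, since the empty set of edges is a line with
  \<open>k = 0\<close>; it is applied to finite \<open>M\<close>.\<close>

definition max_line :: "'a::linorder set set \<Rightarrow> nat" where
  "max_line M = Max (card ` {L. L \<subseteq> M \<and> is_line L})"

lemma is_line_empty: "is_line {}"
  unfolding is_line_def by (rule exI[of _ 0]) simp

lemma card_le_max_line: "finite M \<Longrightarrow> L \<subseteq> M \<Longrightarrow> is_line L \<Longrightarrow> card L \<le> max_line M"
  unfolding max_line_def by (intro Max_ge) auto

lemma max_line_attained:
  assumes "finite M"
  obtains L where "L \<subseteq> M" "is_line L" "card L = max_line M"
proof -
  have "max_line M \<in> card ` {L. L \<subseteq> M \<and> is_line L}"
    unfolding max_line_def using assms is_line_empty by (intro Max_in) auto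
  then obtain L where "L \<in> {L. L \<subseteq> M \<and> is_line L}" "max_line M = card L" ..
  then show ?thesis using that[of L] by simp
qed

lemma is_line_insert:
  assumes "is_line L" "a < b" "\<And>x. x \<in> \<Union>L \<Longrightarrow> b < x"
  shows "is_line (insert {a, b} L)"
proof -
  obtain k f g where L: "L = (\<lambda>i::nat. {f i, g i}) ` {1..k}"
    and s: "sorted_wrt (<) (concat (map (\<lambda>i. [f i, g i]) [1..<Suc k]))"
    using assms(1) unfolding is_line_def by blast
  \<comment> \<open>The edges of \<open>L\<close> move up by one index, which frees index 1 for the
    new leftmost edge.\<close>
  define f' where "f' = (\<lambda>i. if i = 1 then a else f (i - 1))"
  define g' where "g' = (\<lambda>i. if i = 1 then b else g (i - 1))"
  have upt: "[1..<Suc (Suc k)] = 1 # map Suc [1..<Suc k]"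
    by (simp add: upt_conv_Cons map_Suc_upt del: upt_Suc)
  have "map (\<lambda>i. [f' i, g' i]) (map Suc [1..<Suc k]) = map (\<lambda>i. [f i, g i]) [1..<Suc k]"
    by (auto simp: f'_def g'_def simp del: upt_Suc)
  then have c: "concat (map (\<lambda>i. [f' i, g' i]) [1..<Suc (Suc k)]) =
      a # b # concat (map (\<lambda>i. [f i, g i]) [1..<Suc k])"
    unfolding upt by (simp add: f'_def g'_def del: upt_Suc map_map)
  have "b < f i" "b < g i" if "i \<in> {1..k}" for i
    using that by (intro assms(3); force simp: L)+
  then have "\<forall>x\<in>set (concat (map (\<lambda>i. [f i, g i]) [1..<Suc k])). b < x"
    by (auto simp del: upt_Suc)
  then have "sorted_wrt (<) (concat (map (\<lambda>i. [f' i, g' i]) [1..<Suc (Suc k)]))"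
    unfolding c using s assms(2) by (auto simp del: upt_Suc simp: dest: less_trans)
  moreover have "insert {a, b} L = (\<lambda>i. {f' i, g' i}) ` {1..Suc k}"
  proof -
    have "{1..Suc k} = insert 1 (Suc ` {1..k})"
      unfolding image_Suc_atLeastAtMost by auto
    then have "(\<lambda>i. {f' i, g' i}) ` {1..Suc k} =
        insert {a, b} ((\<lambda>i. {f' (Suc i), g' (Suc i)}) ` {1..k})"
      by (simp only: image_insert image_image) (simp add: f'_def g'_def)
    moreover have "(\<lambda>i. {f' (Suc i), g' (Suc i)}) ` {1..k} = L"
      unfolding L by (intro image_cong) (auto simp: f'_def g'_def)
    ultimately show ?thesis by simp
  qed
  ultimately show ?thesis unfolding is_line_def by blast
qed

section \<open>Exposing the vertices of an initial segment\<close>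

lemma odd_card_perfect_matchings: "finite V \<Longrightarrow> odd (card V) \<Longrightarrow> perfect_matchings V = {}"
  using card_Union_perfect_matching by fastforce

lemma card_Diff_doubleton:
  assumes "finite V" "v \<in> V" "w \<in> V" "v \<noteq> w"
  shows "card V = card (V - {v, w}) + 2"
  using assms card.remove[of V v] card.remove[of "V - {v}" w]
  by (simp add: Diff_insert2 [symmetric])

text \<open>Whatever the partners of the vertices in \<open>S\<close> are, the edges missing
  \<open>S\<close> form a uniform matching of some \<open>W\<close>, so a bound on averages that
  holds for every such \<open>W\<close> carries over to \<open>V\<close>. The proof exposes one
  vertex of \<open>S\<close> at a time: each step removes two vertices, at least one of them from
  \<open>S\<close>, so at least \<open>card V - 2 * card S\<close> vertices remain at the
  end.\<close>

lemma sum_perfect_matchings_avoiding: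
  fixes h :: "'a set set \<Rightarrow> real" and C :: real
  assumes "finite V" "S \<subseteq> V"
    and "\<And>W. W \<subseteq> V - S \<Longrightarrow> card V \<le> card W + 2 * card S \<Longrightarrow>
      (\<Sum>M\<in>perfect_matchings W. h M) \<le> C * card (perfect_matchings W)"
  shows "(\<Sum>M\<in>perfect_matchings V. h {e \<in> M. e \<inter> S = {}}) \<le> C * card (perfect_matchings V)"
  using assms
proof (induction "card S" arbitrary: V S rule: less_induct)
  case less
  note h = less.prems(3)
  show ?case
  proof (cases "S = {}")
    case True
    then show ?thesis using h[of V] by simp
  next
    case False
    then obtain v where v: "v \<in> S" by blast
    then have vV: "v \<in> V" and finS: "finite S"
      using less.prems by (auto intro: finite_subset)
    have "(\<Sum>M\<in>perfect_matchings (V - {v, w}). h {e \<in> insert {v, w} M. e \<inter> S = {}})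
        \<le> C * card (perfect_matchings (V - {v, w}))" if w: "w \<in> V - {v}" for w
    proof -
      have less_S: "card (S - {v, w}) < card S"
        using v finS by (intro psubset_card_mono) auto
      have card_V: "card V = card (V - {v, w}) + 2"
        using card_Diff_doubleton[of V v w] less.prems(1) vV w by auto
      have "(\<Sum>M\<in>perfect_matchings (V - {v, w}). h {e \<in> insert {v, w} M. e \<inter> S = {}}) =
          (\<Sum>M\<in>perfect_matchings (V - {v, w}). h {e \<in> M. e \<inter> (S - {v, w}) = {}})"
      proof (rule sum.cong)
        fix M assume "M \<in> perfect_matchings (V - {v, w})"
        then have "e \<inter> (S - {v, w}) = e \<inter> S" if "e \<in> M" for e
          using that by (auto simp: perfect_matchings_def)
        then have "{e \<in> insert {v, w} M. e \<inter> S = {}} = {e \<in> M. e \<inter> (S - {v, w}) = {}}"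
          using v by auto
        then show "h {e \<in> insert {v, w} M. e \<inter> S = {}} = h {e \<in> M. e \<inter> (S - {v, w}) = {}}"
          by simp
      qed simp
      also have "\<dots> \<le> C * card (perfect_matchings (V - {v, w}))"
      proof (rule less.hyps[OF less_S])
        fix W assume "W \<subseteq> V - {v, w} - (S - {v, w})"
          and "card (V - {v, w}) \<le> card W + 2 * card (S - {v, w})"
        then show "(\<Sum>M\<in>perfect_matchings W. h M) \<le> C * card (perfect_matchings W)"
          using less_S card_V by (intro h) auto
      qed (use less.prems in auto)
      finally show ?thesis .
    qed
    then have "(\<Sum>M\<in>perfect_matchings V. h {e \<in> M. e \<inter> S = {}})
        \<le> (\<Sum>w\<in>V - {v}. C * card (perfect_matchings (V - {v, w})))"
      unfolding sum_perfect_matchings[OF less.prems(1) vV] by (rule sum_mono)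
    also have "\<dots> = C * card (perfect_matchings V)"
      using sum_perfect_matchings[OF less.prems(1) vV, of "\<lambda>_. 1 :: real"]
      by (simp add: sum_distrib_left)
    finally show ?thesis .
  qed
qed

text \<open>Exposing the vertices of \<open>S\<close> one at a time, an exposed vertex with \<open>r\<close> unexposed companions
  in \<open>S\<close> avoids them with probability at most \<open>1 - r / N \<le> exp (- r / N)\<close>.\<close>

lemma sum_perfect_matchings_no_inner_edge:
  fixes h :: "'a set set \<Rightarrow> real" and C :: real
  assumes "finite V" "S \<subseteq> V" "card V \<le> N" "C \<ge> 0"
    and "\<And>W. W \<subseteq> V - S \<Longrightarrow> card V \<le> card W + 2 * card S \<Longrightarrow>
      (\<Sum>M\<in>perfect_matchings W. h M) \<le> C * card (perfect_matchings W)"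
  shows "(\<Sum>M\<in>perfect_matchings V. if \<exists>e\<in>M. e \<subseteq> S then 0 else h {e \<in> M. e \<inter> S = {}})
    \<le> C * exp (- (real (card S) * (real (card S) - 1) / (2 * real N))) * card (perfect_matchings V)"
  using assms
proof (induction "card S" arbitrary: V S)
  case 0
  then have "S = {}" using finite_subset by fastforce
  have "{} \<notin> M" if "M \<in> perfect_matchings V" for M
    using that by (auto simp: perfect_matchings_def)
  then have "(\<Sum>M\<in>perfect_matchings V. if \<exists>e\<in>M. e \<subseteq> S then 0 else h {e \<in> M. e \<inter> S = {}}) =
      (\<Sum>M\<in>perfect_matchings V. h M)"
    unfolding \<open>S = {}\<close> by (intro sum.cong) auto
  also have "\<dots> \<le> C * card (perfect_matchings V)"
    using "0.prems"(5)[of V] \<open>S = {}\<close> by simp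
  finally show ?case using \<open>S = {}\<close> by simp
next
  case (Suc r)
  note h = Suc.prems(5)
  obtain v where v: "v \<in> S" using Suc.hyps(2) by fastforce
  then have vV: "v \<in> V" and finS: "finite S"
    using Suc.prems by (auto intro: finite_subset)
  show ?case
  proof (cases "even (card V)")
    case False
    then show ?thesis using odd_card_perfect_matchings Suc.prems(1) by fastforce
  next
    case True
    moreover have "card V > 0" using vV Suc.prems(1) by (auto simp: card_gt_0_iff)
    ultimately obtain m where m: "card V = 2 * Suc m"
      by (metis dvdE gr0_implies_Suc nat_0_less_mult_iff)
    \<comment> \<open>The bound for one partner outside \<open>S\<close>: the induction hypothesis
      with \<open>r\<close> vertices left in \<open>S\<close>, the same \<open>N\<close>, and
      \<open>2 * m\<close> vertices in all.\<close>
    define D where "D = C * exp (- (real r * (real r - 1) / (2 * real N))) * odd_fact m"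
    have D: "D \<ge> 0" unfolding D_def using Suc.prems(4) by simp
    let ?t = "\<lambda>w. \<Sum>M\<in>perfect_matchings (V - {v, w}).
      if \<exists>e\<in>insert {v, w} M. e \<subseteq> S then 0 else h {e \<in> insert {v, w} M. e \<inter> S = {}}"
    \<comment> \<open>A partner inside \<open>S\<close> creates an inner edge, which makes every
      summand vanish.\<close>
    have in_S: "?t w = 0" if "w \<in> S - {v}" for w
      using that v by (intro sum.neutral) auto
    have off_S: "?t w \<le> D" if w: "w \<in> V - S" for w
    proof -
      have S: "S - {v, w} = S - {v}" "card (S - {v}) = r"
        using v w Suc.hyps(2) finS by auto
      have w': "w \<in> V" "w \<noteq> v" using v w by auto
      have card_V: "card (V - {v, w}) = 2 * m"
        using Suc.prems(1) vV w' m by (simp add: card_Diff_subset)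
      have "?t w = (\<Sum>M\<in>perfect_matchings (V - {v, w}).
          if \<exists>e\<in>M. e \<subseteq> S - {v} then 0 else h {e \<in> M. e \<inter> (S - {v}) = {}})"
      proof (rule sum.cong)
        fix M assume M: "M \<in> perfect_matchings (V - {v, w})"
        then have "v \<notin> e" if "e \<in> M" for e
          using that by (auto simp: perfect_matchings_def)
        then have "{e \<in> insert {v, w} M. e \<inter> S = {}} = {e \<in> M. e \<inter> (S - {v}) = {}}"
          "(\<exists>e\<in>insert {v, w} M. e \<subseteq> S) = (\<exists>e\<in>M. e \<subseteq> S - {v})"
          using v w by auto
        then show "(if \<exists>e\<in>insert {v, w} M. e \<subseteq> S then 0
            else h {e \<in> insert {v, w} M. e \<inter> S = {}}) =
          (if \<exists>e\<in>M. e \<subseteq> S - {v} then 0 else h {e \<in> M. e \<inter> (S - {v}) = {}})"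
          by simp
      qed simp
      also have "\<dots> \<le> C * exp (- (real (card (S - {v})) * (real (card (S - {v})) - 1) / (2 * real N))) *
          card (perfect_matchings (V - {v, w}))"
      proof (rule Suc.hyps(1))
        fix W assume W: "W \<subseteq> V - {v, w} - (S - {v})"
          and "card (V - {v, w}) \<le> card W + 2 * card (S - {v})"
        then show "(\<Sum>M\<in>perfect_matchings W. h M) \<le> C * card (perfect_matchings W)"
          using card_V m S Suc.hyps(2) by (intro h) auto
      qed (use Suc.prems S w card_V m in auto)
      also have "\<dots> = D"
        unfolding S D_def using card_V Suc.prems(1) by (simp add: card_perfect_matchings)
      finally show ?thesis .
    qed
    have split: "V - {v} = (S - {v}) \<union> (V - S)" using v Suc.prems(2) by auto
    have N: "card V \<le> N" "N > 0" using Suc.prems(3) m by auto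
    have card_S: "card S \<le> card V" using Suc.prems by (intro card_mono)
    have "(\<Sum>M\<in>perfect_matchings V. if \<exists>e\<in>M. e \<subseteq> S then 0 else h {e \<in> M. e \<inter> S = {}})
        = (\<Sum>w\<in>S - {v}. ?t w) + (\<Sum>w\<in>V - S. ?t w)"
      unfolding sum_perfect_matchings[OF Suc.prems(1) vV] split
      using Suc.prems finS by (intro sum.union_disjoint) auto
    also have "\<dots> \<le> card (V - S) * D"
      using sum_bounded_above[of "V - S" ?t D] in_S off_S by simp
    also have "real (card (V - S)) \<le> (2 * m + 1) * exp (- (r / N))"
    proof -
      have "real (card (V - S)) = (2 * m + 1) - real r"
        using card_S finS Suc.prems m Suc.hyps(2) by (simp add: card_Diff_subset of_nat_diff)
      \<comment> \<open>The number \<open>2 * m + 1\<close> of possible partners is replaced by the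
        larger \<open>N\<close>, which stays fixed through the induction, so that the exponents of
        successive steps have a common denominator.\<close>
      also have "\<dots> \<le> (2 * m + 1) * (1 - r / N)"
      proof -
        have "(2 * m + 1) * (r / N) \<le> N * (r / N)"
          using N m by (intro mult_right_mono) auto
        then show ?thesis using N by (simp add: algebra_simps)
      qed
      also have "\<dots> \<le> (2 * m + 1) * exp (- (r / N))"
        using exp_ge_add_one_self[of "- (r / N)"] by (intro mult_left_mono) auto
      finally show ?thesis .
    qed
    also have "(2 * m + 1) * exp (- (r / N)) * D =
        C * exp (- (real (card S) * (real (card S) - 1) / (2 * real N))) * card (perfect_matchings V)"
    proof -
      \<comment> \<open>The exponents add up because
        \<open>r + r * (r - 1) / 2 = (r + 1) * r / 2\<close>.\<close>
      have E: "exp (- (r / N)) * exp (- (real r * (real r - 1) / (2 * real N))) =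
          exp (- (real (card S) * (real (card S) - 1) / (2 * real N)))"
        unfolding exp_add[symmetric] Suc.hyps(2)[symmetric]
        using N by (simp add: field_simps)
      have c: "real (card (perfect_matchings V)) = real (2 * m + 1) * real (odd_fact m)"
        using card_perfect_matchings[OF Suc.prems(1) m] by (simp only: odd_fact_Suc of_nat_mult)
      show ?thesis unfolding D_def c E[symmetric] by (simp only: mult_ac)
    qed
    finally show ?thesis using D by (simp add: mult_right_mono)
  qed
qed

lemma ex_initial_segment:
  fixes V :: "'a::linorder set"
  assumes "finite V" "s \<le> card V"
  obtains S where "S \<subseteq> V" "card S = s" "\<And>a b. a \<in> S \<Longrightarrow> b \<in> V - S \<Longrightarrow> a < b"
proof -
  have "\<exists>S\<subseteq>V. card S = s \<and> (\<forall>a\<in>S. \<forall>b\<in>V - S. a < b)"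
    using assms(2)
  proof (induction s)
    case (Suc s)
    then obtain S where S: "S \<subseteq> V" "card S = s" "\<forall>a\<in>S. \<forall>b\<in>V - S. a < b" by auto
    have fin: "finite (V - S)" using assms by simp
    moreover have "V - S \<noteq> {}" using S Suc.prems card_mono[of V S] assms by auto
    ultimately have m: "Min (V - S) \<in> V - S" by (rule Min_in)
    have "Min (V - S) < b" if "b \<in> V - insert (Min (V - S)) S" for b
      using that fin by (metis DiffD1 DiffD2 DiffI Min_le insertCI order_less_le)
    then show ?case
      using S m assms by (intro exI[of _ "insert (Min (V - S)) S"])
        (auto simp: card_insert_if finite_subset)
  qed auto
  then show ?thesis using that by blast
qed

text \<open>Each of the \<open>j\<close> rounds exposes the \<open>s\<close> smallest vertices and
  uses up at most \<open>2 * s\<close> vertices. An edge inside this segment precedes all edges that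
  avoid it, so it lengthens their longest line and halves the weight. Weighted by the rest, such an
  edge is missing in at most half of the cases, hence a round gains the factor
  \<open>1 / 2 + 1 / 2 * (1 / 2) = 3 / 4\<close>. As \<open>N\<close> bounds the vertex count in
  every round, the same \<open>s\<close> works throughout.\<close>

lemma sum_half_power_max_line_le:
  fixes V :: "'a::linorder set"
  assumes "finite V" "card V \<le> N" "2 * s * j \<le> card V"
    and s: "exp (- (real s * (real s - 1) / (2 * real N))) \<le> 1 / 2"
  shows "(\<Sum>M\<in>perfect_matchings V. (1 / 2) ^ max_line M) \<le>
    (3 / 4 :: real) ^ j * card (perfect_matchings V)"
  using assms(1-3)
proof (induction j arbitrary: V)
  case 0
  show ?case
    using sum_bounded_above[of "perfect_matchings V" "\<lambda>M. (1 / 2) ^ max_line M" "1 :: real"]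
    by (simp add: power_le_one)
next
  case (Suc j)
  have sV: "s \<le> card V" using Suc.prems(3) by simp
  obtain S where S: "S \<subseteq> V" "card S = s" "\<And>a b. a \<in> S \<Longrightarrow> b \<in> V - S \<Longrightarrow> a < b"
    using ex_initial_segment[OF Suc.prems(1) sV] by blast
  define h where "h M = (1 / 2 :: real) ^ max_line M" for M :: "'a set set"
  have IH: "(\<Sum>M\<in>perfect_matchings W. h M) \<le> (3 / 4) ^ j * card (perfect_matchings W)"
    if "W \<subseteq> V - S" "card V \<le> card W + 2 * card S" for W
    unfolding h_def
  proof (rule Suc.IH)
    show "finite W" using that(1) Suc.prems(1) finite_subset by blast
    have "card W \<le> card V" using that(1) Suc.prems(1) by (intro card_mono) auto
    then show "card W \<le> N" using Suc.prems(2) by simp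
    show "2 * s * j \<le> card W" using that(2) S(2) Suc.prems(3) by simp
  qed
  let ?off = "\<lambda>M. {e \<in> M. e \<inter> S = {}}"
  let ?g = "\<lambda>M. if \<exists>e\<in>M. e \<subseteq> S then 0 else h (?off M)"
  \<comment> \<open>One inequality for both cases: with an inner edge the second term is 0 and the
    weight is halved; without one the two terms add up to \<open>h (?off M)\<close>.\<close>
  have "h M \<le> 1 / 2 * h (?off M) + 1 / 2 * ?g M" if M: "M \<in> perfect_matchings V" for M
  proof -
    have fin: "finite M" using finite_perfect_matching[OF Suc.prems(1) M] .
    obtain L where L: "L \<subseteq> ?off M" "is_line L" "card L = max_line (?off M)"
      using max_line_attained[of "?off M"] fin by auto
    show ?thesis
    proof (cases "\<exists>e\<in>M. e \<subseteq> S")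
      case True
      then obtain e where e: "e \<in> M" "e \<subseteq> S" by blast
      then have "card e = 2" using M by (simp add: perfect_matchings_def)
      then obtain a b where ab: "e = {a, b}" "a < b"
        by (metis card_2_iff insert_commute linorder_neqE)
      have "b < x" if "x \<in> \<Union>L" for x
        using that L(1) M S(3)[of b x] e ab by (auto simp: perfect_matchings_def)
      then have "is_line (insert e L)"
        unfolding ab(1) using L(2) ab(2) by (intro is_line_insert)
      then have "card (insert e L) \<le> max_line M"
        using L(1) e(1) fin by (intro card_le_max_line) auto
      moreover have "e \<notin> L" using L(1) e ab by auto
      moreover have "finite L" using finite_subset[OF L(1)] fin by simp
      ultimately have "Suc (max_line (?off M)) \<le> max_line M" using L(3) by simp
      then have "h M \<le> (1 / 2) ^ Suc (max_line (?off M))"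
        unfolding h_def by (intro power_decreasing) auto
      then show ?thesis using True by (simp add: h_def)
    next
      case False
      have "max_line (?off M) \<le> max_line M"
        using L(1) card_le_max_line[OF fin _ L(2)] L(3) by auto
      then have "h M \<le> h (?off M)" unfolding h_def by (intro power_decreasing) auto
      then show ?thesis using False by simp
    qed
  qed
  then have "(\<Sum>M\<in>perfect_matchings V. h M) \<le>
      (\<Sum>M\<in>perfect_matchings V. 1 / 2 * h (?off M) + 1 / 2 * ?g M)"
    by (rule sum_mono)
  also have "\<dots> = 1 / 2 * (\<Sum>M\<in>perfect_matchings V. h (?off M)) +
      1 / 2 * (\<Sum>M\<in>perfect_matchings V. ?g M)"
    by (simp only: sum.distrib sum_distrib_left)
  \<comment> \<open>Both sums are averages over the edges that avoid \<open>S\<close>; the second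
    one gains a further factor \<open>1 / 2\<close> because it requires that there is no inner
    edge.\<close>
  also have "\<dots> \<le> 1 / 2 * ((3 / 4) ^ j * card (perfect_matchings V)) +
      1 / 2 * ((3 / 4) ^ j * (1 / 2) * card (perfect_matchings V))"
  proof (intro add_mono mult_left_mono)
    show "(\<Sum>M\<in>perfect_matchings V. h (?off M)) \<le> (3 / 4) ^ j * card (perfect_matchings V)"
      using Suc.prems(1) S(1) IH by (rule sum_perfect_matchings_avoiding)
    have "(\<Sum>M\<in>perfect_matchings V. ?g M) \<le>
        (3 / 4) ^ j * exp (- (real (card S) * (real (card S) - 1) / (2 * real N))) * card (perfect_matchings V)"
      by (rule sum_perfect_matchings_no_inner_edge[OF Suc.prems(1) S(1) Suc.prems(2) _ IH]) auto
    also have "\<dots> \<le> (3 / 4) ^ j * (1 / 2) * card (perfect_matchings V)"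
      using s unfolding S(2) by (intro mult_left_mono mult_right_mono) auto
    finally show "(\<Sum>M\<in>perfect_matchings V. ?g M) \<le>
      (3 / 4) ^ j * (1 / 2) * card (perfect_matchings V)" .
  qed auto
  also have "\<dots> = (3 / 4) ^ Suc j * card (perfect_matchings V)" by simp
  finally show ?case unfolding h_def .
qed

text \<open>Markov's inequality for \<open>(1 / 2) ^ max_line M\<close>. With about
  \<open>sqrt n / 2\<close> rounds the average is about \<open>(3 / 4) powr (sqrt n / 2)\<close>,
  that is \<open>(81 / 256) powr (sqrt n / 8)\<close>. A short line has weight at least
  \<open>(1 / 2) powr (sqrt n / 8)\<close>, and the quotient of the bases is
  \<open>81 / 128 < 1\<close>.\<close>

lemma card_short_max_line_le:
  assumes "n \<ge> 36"
  shows "real (card {M \<in> perfect_matchings {1..2 * n}. max_line M < 1 / 8 * sqrt n}) \<le>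
    4 / 3 * (81 / 128) powr (1 / 8 * sqrt n) * odd_fact n"
proof -
  let ?V = "{1..2 * n}" and ?B = "{M \<in> perfect_matchings {1..2 * n}. max_line M < 1 / 8 * sqrt n}"
  \<comment> \<open>For this \<open>s\<close> the exponent \<open>s * (s - 1) / (4 * n)\<close> is
    near 1; \<open>n \<ge> 36\<close> gives \<open>6 * sqrt n \<le> n\<close> and so keeps it above
    \<open>3 / 4\<close>.\<close>
  define s where "s = nat \<lfloor>2 * sqrt n\<rfloor>"
  define j where "j = n div s"
  have sqrt6: "sqrt n \<ge> 6" using assms by (simp add: real_le_rsqrt)
  have s: "real s \<le> 2 * sqrt n" "real s > 2 * sqrt n - 1"
    unfolding s_def using sqrt6 assms by linarith+
  have "(2 * sqrt n - 1) * (2 * sqrt n - 2) \<le> real s * (real s - 1)"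
    using s sqrt6 by (intro mult_mono) linarith+
  moreover have "(2 * sqrt n - 1) * (2 * sqrt n - 2) = 4 * n - 6 * sqrt n + 2"
    by (simp add: algebra_simps)
  moreover have "6 * sqrt n \<le> sqrt n * sqrt n"
    using sqrt6 by (intro mult_right_mono) auto
  ultimately have "3 / 4 * (4 * real n) \<le> real s * (real s - 1)" by simp
  then have y: "3 / 4 \<le> real s * (real s - 1) / (2 * real (2 * n))"
    using assms by (simp add: field_simps)
  \<comment> \<open>The quadratic Taylor polynomial at \<open>3 / 4\<close> equals
    \<open>65 / 32\<close>.\<close>
  have "2 \<le> exp (3 / 4 :: real)"
    using exp_lower_Taylor_quadratic[of "3 / 4 :: real"] by (simp add: power2_eq_square)
  also have "\<dots> \<le> exp (real s * (real s - 1) / (2 * real (2 * n)))" using y by simp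
  finally have exps: "exp (- (real s * (real s - 1) / (2 * real (2 * n)))) \<le> 1 / 2"
    by (simp add: exp_minus field_simps)
  have "real j \<ge> real n / real s - 1"
    unfolding j_def using floor_divide_of_nat_eq[of n s, where 'a = real]
      real_of_int_floor_gt_diff_one[of "real n / real s"] by simp
  moreover have "real n / real s \<ge> real n / (2 * sqrt n)"
    using s sqrt6 by (intro divide_left_mono mult_pos_pos) linarith+
  moreover have "real n / (2 * sqrt n) = sqrt n / 2"
    by (metis divide_divide_eq_left' real_div_sqrt of_nat_0_le_iff)
  ultimately have j: "real j \<ge> sqrt n / 2 - 1" by linarith
  have "real (card ?B) * (1 / 2) powr (1 / 8 * sqrt n) = (\<Sum>M\<in>?B. (1 / 2) powr (1 / 8 * sqrt n))"
    by simp
  also have "\<dots> \<le> (\<Sum>M\<in>?B. (1 / 2) ^ max_line M)"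
  proof (rule sum_mono)
    fix M assume "M \<in> ?B"
    then have "(1 / 2 :: real) powr (1 / 8 * sqrt n) \<le> (1 / 2) powr (max_line M)"
      by (intro powr_mono') auto
    then show "(1 / 2 :: real) powr (1 / 8 * sqrt n) \<le> (1 / 2) ^ max_line M"
      by (simp add: powr_realpow)
  qed
  also have "\<dots> \<le> (\<Sum>M\<in>perfect_matchings ?V. (1 / 2) ^ max_line M)"
    by (intro sum_mono2 finite_perfect_matchings) auto
  also have "\<dots> \<le> (3 / 4) ^ j * card (perfect_matchings ?V)"
    by (rule sum_half_power_max_line_le[OF _ _ _ exps])
      (auto simp: j_def mult.commute[of "2 * s"] intro: order_trans[OF _ div_times_less_eq_dividend[of n s]])
  also have "card (perfect_matchings ?V) = odd_fact n" by (simp add: card_perfect_matchings)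
  also have "(3 / 4 :: real) ^ j = (3 / 4) powr j" by (simp add: powr_realpow)
  also have "(3 / 4 :: real) powr j \<le> (3 / 4) powr (sqrt n / 2 - 1)"
    using j by (intro powr_mono') auto
  \<comment> \<open>The factor \<open>4 / 3\<close> pays for the \<open>- 1\<close> in the lower
    bound on \<open>j\<close>, which comes from rounding in \<open>n div s\<close>.\<close>
  also have "\<dots> = 4 / 3 * (81 / 256) powr (1 / 8 * sqrt n)"
  proof -
    have "(81 / 256 :: real) = (3 / 4) powr 4" by (simp add: powr_numeral power4_eq_xxxx)
    then have "(81 / 256 :: real) powr (1 / 8 * sqrt n) = (3 / 4) powr (sqrt n / 2)"
      by (simp only: powr_powr) simp
    then show ?thesis by (simp add: powr_diff)
  qed
  finally have "real (card ?B) * (1 / 2) powr (1 / 8 * sqrt n)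
      \<le> 4 / 3 * (81 / 256) powr (1 / 8 * sqrt n) * odd_fact n"
    by (simp add: mult_right_mono)
  then have "real (card ?B) * ((1 / 2) powr (1 / 8 * sqrt n) * 2 powr (1 / 8 * sqrt n))
      \<le> 4 / 3 * ((81 / 256) powr (1 / 8 * sqrt n) * 2 powr (1 / 8 * sqrt n)) * odd_fact n"
    by (simp add: mult.assoc[symmetric] mult_right_mono)
  then show ?thesis by (simp add: powr_mult[symmetric])
qed

section \<open>The expected number of stacks and waves\<close>

lemma vertices_of_edge_list:
  "set (map a [1..<Suc k]) \<union> set (map b [1..<Suc k]) = \<Union>((\<lambda>i. {a i, b i}) ` {1..k})"
  by (simp only: set_map set_upt atLeastLessThanSuc_atLeastAtMost) blast

text \<open>The increasing enumeration of the vertices is unique. Its first half lists the left ends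
  and its second half the right ends, so the \<open>i\<close>-th vertex is joined to the one
  \<open>k\<close> places later.\<close>

lemma wave_determined_by_vertices: "inj_on Union {F :: 'a::linorder set set. is_wave F}"
proof (rule inj_onI)
  fix F F' :: "'a set set"
  assume "F \<in> {F. is_wave F}" "F' \<in> {F. is_wave F}" and U: "\<Union>F = \<Union>F'"
  then obtain k a b k' a' b' where
    F: "F = (\<lambda>i::nat. {a i, b i}) ` {1..k}"
      "sorted_wrt (<) (map a [1..<Suc k] @ map b [1..<Suc k])" and
    F': "F' = (\<lambda>i::nat. {a' i, b' i}) ` {1..k'}"
      "sorted_wrt (<) (map a' [1..<Suc k'] @ map b' [1..<Suc k'])"
    unfolding is_wave_def mem_Collect_eq by blast
  have sets: "set (map a [1..<Suc k] @ map b [1..<Suc k]) = \<Union>F"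
    "set (map a' [1..<Suc k'] @ map b' [1..<Suc k']) = \<Union>F'"
    unfolding F(1) F'(1) set_append set_rev vertices_of_edge_list by simp_all
  have eq: "map a [1..<Suc k] @ map b [1..<Suc k] = map a' [1..<Suc k'] @ map b' [1..<Suc k']"
    using strict_sorted_equal[OF F(2) F'(2)] sets U by metis
  have k: "k = k'"
    using arg_cong[OF eq, of length] by (simp del: upt_Suc)
  then have "map a [1..<Suc k] = map a' [1..<Suc k] \<and> map b [1..<Suc k] = map b' [1..<Suc k]"
    using eq by (simp del: upt_Suc)
  then have "a i = a' i" "b i = b' i" if "i \<in> {1..k}" for i
    using that by (auto simp del: upt_Suc)
  then show "F = F'" unfolding F(1) F'(1) k[symmetric] by (intro image_cong) auto
qed

text \<open>As for waves, but the second half is read backwards: the \<open>i\<close>-th vertex is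
  joined to the \<open>i\<close>-th from the end.\<close>

lemma stack_determined_by_vertices: "inj_on Union {F :: 'a::linorder set set. is_stack F}"
proof (rule inj_onI)
  fix F F' :: "'a set set"
  assume "F \<in> {F. is_stack F}" "F' \<in> {F. is_stack F}" and U: "\<Union>F = \<Union>F'"
  then obtain k a b k' a' b' where
    F: "F = (\<lambda>i::nat. {a i, b i}) ` {1..k}"
      "sorted_wrt (<) (map a [1..<Suc k] @ rev (map b [1..<Suc k]))" and
    F': "F' = (\<lambda>i::nat. {a' i, b' i}) ` {1..k'}"
      "sorted_wrt (<) (map a' [1..<Suc k'] @ rev (map b' [1..<Suc k']))"
    unfolding is_stack_def mem_Collect_eq by blast
  have sets: "set (map a [1..<Suc k] @ rev (map b [1..<Suc k])) = \<Union>F"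
    "set (map a' [1..<Suc k'] @ rev (map b' [1..<Suc k'])) = \<Union>F'"
    unfolding F(1) F'(1) set_append set_rev vertices_of_edge_list by simp_all
  have eq: "map a [1..<Suc k] @ rev (map b [1..<Suc k]) =
      map a' [1..<Suc k'] @ rev (map b' [1..<Suc k'])"
    using strict_sorted_equal[OF F(2) F'(2)] sets U by metis
  have k: "k = k'"
    using arg_cong[OF eq, of length] by (simp del: upt_Suc)
  then have "map a [1..<Suc k] = map a' [1..<Suc k] \<and> map b [1..<Suc k] = map b' [1..<Suc k]"
    using eq by (simp del: upt_Suc)
  then have "a i = a' i" "b i = b' i" if "i \<in> {1..k}" for i
    using that by (auto simp del: upt_Suc)
  then show "F = F'" unfolding F(1) F'(1) k[symmetric] by (intro image_cong) auto
qed

text \<open>A union bound. By injectivity there are at most as many patterns with \<open>k\<close>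
  edges as sets of \<open>2 * k\<close> vertices, and each pattern lies in
  \<open>odd_fact (n - k)\<close> matchings. Here \<open>P\<close> stands for
  \<open>is_stack\<close> or \<open>is_wave\<close>.\<close>

lemma card_containing_pattern_le:
  assumes "inj_on Union {F. P F}" and "finite V" "card V = 2 * n"
  shows "card {M \<in> perfect_matchings V. \<exists>F\<subseteq>M. P F \<and> card F = k}
    \<le> (2 * n choose (2 * k)) * odd_fact (n - k)"
proof -
  define \<F> where "\<F> = {F. P F \<and> card F = k \<and> F \<in> perfect_matchings (\<Union>F) \<and> \<Union>F \<subseteq> V}"
  have cU: "card (\<Union>F) = 2 * k" "\<Union>F \<subseteq> V" "F \<in> perfect_matchings (\<Union>F)" if "F \<in> \<F>" for F
    using that card_Union_perfect_matching[of "\<Union>F" F] assms(2)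
    by (auto simp: \<F>_def dest: finite_subset)
  have fin: "finite \<F>"
    by (rule finite_subset[of _ "Pow (Pow V)"]) (use assms(2) in \<open>auto simp: \<F>_def\<close>)
  have "card \<F> = card (Union ` \<F>)"
    by (intro card_image[symmetric] inj_on_subset[OF assms(1)]) (auto simp: \<F>_def)
  also have "\<dots> \<le> card {U. U \<subseteq> V \<and> card U = 2 * k}"
    using cU assms(2) by (intro card_mono) auto
  also have "\<dots> = (2 * n choose (2 * k))" using n_subsets[OF assms(2)] assms(3) by simp
  finally have c\<F>: "card \<F> \<le> (2 * n choose (2 * k))" .
  have "{M \<in> perfect_matchings V. \<exists>F\<subseteq>M. P F \<and> card F = k} \<subseteq>
      (\<Union>F\<in>\<F>. {M \<in> perfect_matchings V. F \<subseteq> M})"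
  proof
    fix M assume "M \<in> {M \<in> perfect_matchings V. \<exists>F\<subseteq>M. P F \<and> card F = k}"
    then obtain F where M: "M \<in> perfect_matchings V" and F: "F \<subseteq> M" "P F" "card F = k" by blast
    have "\<Union>F \<subseteq> V" using M F(1) by (auto simp: perfect_matchings_def)
    then have "F \<in> \<F>"
      using perfect_matchings_subset[OF M F(1)] F by (simp add: \<F>_def)
    then show "M \<in> (\<Union>F\<in>\<F>. {M \<in> perfect_matchings V. F \<subseteq> M})" using M F(1) by blast
  qed
  then have "card {M \<in> perfect_matchings V. \<exists>F\<subseteq>M. P F \<and> card F = k} \<le>
      card (\<Union>F\<in>\<F>. {M \<in> perfect_matchings V. F \<subseteq> M})"
    using fin finite_perfect_matchings[OF assms(2)] by (intro card_mono) auto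
  also have "\<dots> \<le> (\<Sum>F\<in>\<F>. card {M \<in> perfect_matchings V. F \<subseteq> M})"
    using fin by (rule card_UN_le)
  also have "\<dots> = (\<Sum>F\<in>\<F>. odd_fact (n - k))"
  proof (rule sum.cong)
    fix F assume F: "F \<in> \<F>"
    have "card (V - \<Union>F) = 2 * (n - k)"
      using cU[OF F] assms by (simp add: card_Diff_subset finite_subset)
    then show "card {M \<in> perfect_matchings V. F \<subseteq> M} = odd_fact (n - k)"
      using card_perfect_matchings_supset[of F "\<Union>F" V] cU[OF F] assms(2)
      by (simp add: card_perfect_matchings)
  qed simp
  also have "\<dots> \<le> (2 * n choose (2 * k)) * odd_fact (n - k)" using c\<F> by simp
  finally show ?thesis .
qed

section \<open>First-moment estimate\<close>

text \<open>\<open>m ^ m / fact m\<close> is one term of the exponential series for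
  \<open>exp m\<close>, whose terms are all nonnegative.\<close>

lemma power_le_fact_exp: "real m ^ m \<le> fact m * exp (real m)"
proof -
  have s: "(\<lambda>i. inverse (fact i) * real m ^ i) sums exp (real m)"
    using exp_converges[of "real m"] by (simp add: scaleR_conv_of_real)
  have "(\<Sum>i\<in>{m}. inverse (fact i) * real m ^ i) \<le> exp (real m)"
    using s by (subst sums_unique[OF s]) (intro sum_le_suminf, auto simp: sums_iff)
  then show ?thesis by (simp add: field_simps)
qed

text \<open>Cancelling factorials shows that the left side times \<open>fact (2 * k)\<close> is
  \<open>odd_fact n * 2 ^ k\<close> times the falling factorial
  \<open>n * (n - 1) * \<dots> * (n - k + 1)\<close>. The latter is at most \<open>n ^ k\<close>,
  and \<open>fact (2 * k)\<close> is at least \<open>(2 * k / e) ^ (2 * k)\<close>. For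
  \<open>k > n\<close> the binomial coefficient vanishes.\<close>

lemma expected_number_le:
  assumes "k \<ge> 1"
  shows "real ((2 * n choose (2 * k)) * odd_fact (n - k)) \<le>
    (exp 1 ^ 2 * n / (2 * real k ^ 2)) ^ k * odd_fact n"
proof (cases "k \<le> n")
  case False
  then have *: "2 * n choose (2 * k) = 0" by (intro binomial_eq_0) simp
  show ?thesis unfolding * by simp
next
  case True
  have F: "fact (2 * j) = real (odd_fact j) * (fact j * 2 ^ j)" for j
    using arg_cong[OF odd_fact_fact[of j], of real] by simp
  have kn: "2 * k \<le> 2 * n" using True by simp
  have sub: "2 * n - 2 * k = 2 * (n - k)" by simp
  have "real ((2 * n choose (2 * k)) * odd_fact (n - k)) * fact (2 * k) * (fact (n - k) * 2 ^ (n - k))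
      = real (2 * n choose (2 * k)) * fact (2 * k) * fact (2 * n - 2 * k)"
    unfolding sub F[of "n - k"] by (simp add: mult_ac)
  also have "\<dots> = fact (2 * n)"
    using binomial_fact[OF kn, where 'a = real] by (simp add: field_simps)
  also have "\<dots> = real (odd_fact n) * (fact n * 2 ^ n)" by (rule F)
  also have "fact n = real (n choose k) * fact k * fact (n - k)"
    using binomial_fact[OF True, where 'a = real] by (simp add: field_simps)
  also have "(2 :: real) ^ n = 2 ^ k * 2 ^ (n - k)"
    using True by (simp add: power_add[symmetric])
  finally have "real ((2 * n choose (2 * k)) * odd_fact (n - k)) * fact (2 * k) * (fact (n - k) * 2 ^ (n - k))
      = (real (odd_fact n) * (real (n choose k) * fact k) * 2 ^ k) * (fact (n - k) * 2 ^ (n - k))"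
    by (simp add: mult_ac)
  then have eq: "real ((2 * n choose (2 * k)) * odd_fact (n - k)) * fact (2 * k) =
      real (odd_fact n) * (real (n choose k) * fact k) * 2 ^ k"
    by (subst (asm) mult_right_cancel) auto
  have "real (n choose k) * fact k = real ((n choose k) * fact k)" by simp
  also have "\<dots> \<le> real (n ^ k)" using binomial_fact_pow by (intro of_nat_mono)
  finally have pow: "real (n choose k) * fact k \<le> real n ^ k" by simp
  have "real ((2 * n choose (2 * k)) * odd_fact (n - k)) * real (2 * k) ^ (2 * k) \<le>
      real ((2 * n choose (2 * k)) * odd_fact (n - k)) * (fact (2 * k) * exp (real (2 * k)))"
    by (intro mult_left_mono power_le_fact_exp) simp
  also have "\<dots> = real (odd_fact n) * (real (n choose k) * fact k) * 2 ^ k * exp (real (2 * k))"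
    using eq by (simp add: mult_ac)
  also have "\<dots> \<le> real (odd_fact n) * real n ^ k * 2 ^ k * exp (real (2 * k))"
    using pow by (intro mult_right_mono mult_left_mono) auto
  also have "\<dots> = (exp 1 ^ 2 * n * 2) ^ k * odd_fact n"
    by (simp add: power_mult_distrib exp_of_nat_mult[symmetric] power_mult[symmetric] mult_ac)
  finally have "real ((2 * n choose (2 * k)) * odd_fact (n - k)) * ((2 * real k) ^ 2) ^ k \<le>
      (exp 1 ^ 2 * n * 2) ^ k * odd_fact n"
    by (simp add: power_mult)
  then have "real ((2 * n choose (2 * k)) * odd_fact (n - k)) \<le>
      (exp 1 ^ 2 * n * 2) ^ k * odd_fact n / ((2 * real k) ^ 2) ^ k"
    using assms by (subst pos_le_divide_eq) auto
  also have "\<dots> = (exp 1 ^ 2 * n * 2 / (2 * real k) ^ 2) ^ k * odd_fact n"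
    by (simp only: power_divide times_divide_eq_left)
  also have "exp 1 ^ 2 * n * 2 / (2 * real k) ^ 2 = exp 1 ^ 2 * n / (2 * real k ^ 2)"
    by (simp add: power2_eq_square)
  finally show ?thesis .
qed

section \<open>Edges across the middle and the Erdos--Szekeres argument\<close>

text \<open>The rank \<open>u x\<close> is the largest size of a chain in \<open>C\<close> with
  greatest element \<open>x\<close>. If \<open>R x y\<close>, then \<open>y\<close> can be appended
  to such a chain, so the rank of \<open>y\<close> is larger.\<close>

lemma rank_in_bounded_chains:
  fixes R :: "'e \<Rightarrow> 'e \<Rightarrow> bool"
  assumes "finite C"
    and trans: "\<And>x y z. R x y \<Longrightarrow> R y z \<Longrightarrow> R x z" and irrefl: "\<And>x. \<not> R x x"
    and chains: "\<And>T. T \<subseteq> C \<Longrightarrow> (\<And>x y. x \<in> T \<Longrightarrow> y \<in> T \<Longrightarrow> x \<noteq> y \<Longrightarrow> R x y \<or> R y x) \<Longrightarrow> card T \<le> s"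
  obtains u where "\<And>x. x \<in> C \<Longrightarrow> u x \<in> {1..s}"
    "\<And>x y. x \<in> C \<Longrightarrow> y \<in> C \<Longrightarrow> R x y \<Longrightarrow> u x < (u y :: nat)"
proof -
  define \<T> where "\<T> x = {T. T \<subseteq> C \<and> x \<in> T \<and> (\<forall>y\<in>T. y = x \<or> R y x) \<and>
    (\<forall>y\<in>T. \<forall>z\<in>T. y \<noteq> z \<longrightarrow> R y z \<or> R z y)}" for x
  define u where "u x = Max (card ` \<T> x)" for x
  have fin: "finite (\<T> x)" for x
    by (rule finite_subset[of _ "Pow C"]) (use assms(1) in \<open>auto simp: \<T>_def\<close>)
  have ne: "{x} \<in> \<T> x" if "x \<in> C" for x
    using that by (simp add: \<T>_def)
  have le: "card T \<le> u x" if "T \<in> \<T> x" for T x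
    unfolding u_def using fin that by (intro Max_ge) auto
  have att: "\<exists>T\<in>\<T> x. card T = u x" if "x \<in> C" for x
  proof -
    have "u x \<in> card ` \<T> x"
      unfolding u_def using fin ne[OF that] by (intro Max_in) auto
    then show ?thesis by auto
  qed
  show thesis
  proof
    fix x assume x: "x \<in> C"
    obtain T where T: "T \<in> \<T> x" "card T = u x" using att[OF x] by blast
    then have "card T \<le> s" by (intro chains) (auto simp: \<T>_def)
    then show "u x \<in> {1..s}" using T le[OF ne[OF x]] by simp
  next
    fix x y assume x: "x \<in> C" and y: "y \<in> C" and xy: "R x y"
    obtain T where T: "T \<in> \<T> x" "card T = u x" using att[OF x] by blast
    have Ry: "R z y" if "z \<in> T" for z
    proof -
      have "z = x \<or> R z x" using T(1) that by (auto simp: \<T>_def)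
      then show ?thesis using xy trans[of z x y] by auto
    qed
    have "y \<notin> T" using Ry irrefl by blast
    have "insert y T \<in> \<T> y"
      using T(1) Ry y by (auto simp: \<T>_def)
    moreover have "finite T"
      using T(1) finite_subset[OF _ assms(1), of T] by (simp add: \<T>_def)
    ultimately have "Suc (card T) \<le> u y" using le[of "insert y T" y] \<open>y \<notin> T\<close> by simp
    then show "u x < u y" using T(2) by simp
  qed
qed

text \<open>Each element gets two ranks, from the increasing and from the decreasing chains ending
  in it. For any two elements one of the two ranks differs, so the pairs of ranks are distinct, and
  there are only \<open>s * t\<close> pairs.\<close>

lemma Erdos_Szekeres:
  fixes f g :: "'e \<Rightarrow> 'a::linorder"
  assumes "finite C" "inj_on f C" "inj_on g C"
    and incr: "\<And>T. T \<subseteq> C \<Longrightarrow> (\<And>x y. x \<in> T \<Longrightarrow> y \<in> T \<Longrightarrow> f x < f y \<Longrightarrow> g x < g y) \<Longrightarrow> card T \<le> s"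
    and decr: "\<And>T. T \<subseteq> C \<Longrightarrow> (\<And>x y. x \<in> T \<Longrightarrow> y \<in> T \<Longrightarrow> f x < f y \<Longrightarrow> g y < g x) \<Longrightarrow> card T \<le> t"
  shows "card C \<le> s * t"
proof -
  have "\<exists>u. (\<forall>x\<in>C. u x \<in> {1..s}) \<and> (\<forall>x\<in>C. \<forall>y\<in>C. f x < f y \<and> g x < g y \<longrightarrow> u x < (u y :: nat))"
  proof (rule rank_in_bounded_chains[OF assms(1), of "\<lambda>x y. f x < f y \<and> g x < g y" s])
    fix T assume "T \<subseteq> C" and "\<And>x y. x \<in> T \<Longrightarrow> y \<in> T \<Longrightarrow> x \<noteq> y \<Longrightarrow>
      f x < f y \<and> g x < g y \<or> f y < f x \<and> g y < g x"
    then show "card T \<le> s" by (intro incr) (auto dest: less_asym)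
  qed auto
  then obtain u where u: "\<And>x. x \<in> C \<Longrightarrow> u x \<in> {1..s}"
    "\<And>x y. x \<in> C \<Longrightarrow> y \<in> C \<Longrightarrow> f x < f y \<Longrightarrow> g x < g y \<Longrightarrow> u x < (u y :: nat)" by blast
  have "\<exists>u. (\<forall>x\<in>C. u x \<in> {1..t}) \<and> (\<forall>x\<in>C. \<forall>y\<in>C. f x < f y \<and> g y < g x \<longrightarrow> u x < (u y :: nat))"
  proof (rule rank_in_bounded_chains[OF assms(1), of "\<lambda>x y. f x < f y \<and> g y < g x" t])
    fix T assume "T \<subseteq> C" and "\<And>x y. x \<in> T \<Longrightarrow> y \<in> T \<Longrightarrow> x \<noteq> y \<Longrightarrow>
      f x < f y \<and> g y < g x \<or> f y < f x \<and> g x < g y"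
    then show "card T \<le> t" by (intro decr) (auto dest: less_asym)
  qed auto
  then obtain d where d: "\<And>x. x \<in> C \<Longrightarrow> d x \<in> {1..t}"
    "\<And>x y. x \<in> C \<Longrightarrow> y \<in> C \<Longrightarrow> f x < f y \<Longrightarrow> g y < g x \<Longrightarrow> d x < (d y :: nat)" by blast
  have "(u x, d x) \<noteq> (u y, d y)" if "x \<in> C" "y \<in> C" "f x < f y" for x y
  proof -
    have "g x \<noteq> g y" using that assms(3) by (auto dest: inj_onD)
    then show ?thesis using u(2)[OF that] d(2)[OF that] by (auto dest: neq_iff[THEN iffD1])
  qed
  then have "inj_on (\<lambda>x. (u x, d x)) C"
    using assms(2) by (intro inj_onI) (metis inj_onD linorder_neqE)
  then have "card C \<le> card ({1..s} \<times> {1..t})"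
    using u(1) d(1) by (intro card_inj_on_le) auto
  then show ?thesis by simp
qed

section \<open>Monotone sets of edges as waves and stacks\<close>

lemma obtain_sorted_list:
  fixes f :: "'e \<Rightarrow> 'a::linorder"
  assumes "finite T" "inj_on f T"
  obtains xs where "set xs = T" "length xs = card T" "sorted_wrt (\<lambda>x y. f x < f y) xs"
proof -
  obtain ys where ys: "set ys = T" "distinct ys" using finite_distinct_list[OF assms(1)] by blast
  have "distinct (map f (sort_key f ys))" using ys assms(2) by (simp add: distinct_map)
  then have "sorted_wrt (<) (map f (sort_key f ys))" by (simp add: strict_sorted_iff)
  then show thesis
    using that[of "sort_key f ys"] ys distinct_card[OF ys(2)] by (simp add: sorted_wrt_map)
qed

text \<open>Waves and stacks number their edges from 1 while lists are indexed from 0, hence the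
  shift.\<close>

lemma map_nth_upt_Suc: "map (\<lambda>i. f (xs ! (i - 1))) [1..<Suc (length xs)] = map f xs"
  by (intro nth_equalityI) (auto simp del: upt_Suc)

lemma image_nth_upt_Suc: "(\<lambda>i. h (xs ! (i - 1))) ` {1..length xs} = h ` set xs"
  using arg_cong[OF map_nth_upt_Suc[of h xs], of set]
  by (simp add: atLeastLessThanSuc_atLeastAtMost del: upt_Suc)

text \<open>Listing the edges by left end puts the right ends in increasing order too, and the last
  hypothesis places all left ends before all right ends.\<close>

lemma is_wave_of_increasing:
  fixes f g :: "'a::linorder set \<Rightarrow> 'a"
  assumes "finite T" "inj_on f T" "\<And>e. e \<in> T \<Longrightarrow> e = {f e, g e}"
    and "\<And>x y. x \<in> T \<Longrightarrow> y \<in> T \<Longrightarrow> f x < f y \<Longrightarrow> g x < g y"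
    and "\<And>x y. x \<in> T \<Longrightarrow> y \<in> T \<Longrightarrow> f x < g y"
  shows "is_wave T"
proof -
  obtain xs where xs: "set xs = T" "length xs = card T" "sorted_wrt (\<lambda>x y. f x < f y) xs"
    using obtain_sorted_list[OF assms(1,2)] by blast
  have "sorted_wrt (\<lambda>x y. g x < g y) xs"
    using xs(1) assms(4) by (intro sorted_wrt_mono_rel[OF _ xs(3)]) auto
  then have "sorted_wrt (<) (map f xs @ map g xs)"
    using xs assms(5) by (simp add: sorted_wrt_append sorted_wrt_map)
  moreover have "(\<lambda>e. {f e, g e}) ` set xs = T"
    using assms(3) unfolding xs(1) by force
  ultimately show ?thesis
    unfolding is_wave_def
    by (intro exI[of _ "length xs"] exI[of _ "\<lambda>i. f (xs ! (i - 1))"] exI[of _ "\<lambda>i. g (xs ! (i - 1))"])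
      (simp only: map_nth_upt_Suc image_nth_upt_Suc[of "\<lambda>e. {f e, g e}"])
qed

lemma is_stack_of_decreasing:
  fixes f g :: "'a::linorder set \<Rightarrow> 'a"
  assumes "finite T" "inj_on f T" "\<And>e. e \<in> T \<Longrightarrow> e = {f e, g e}"
    and "\<And>x y. x \<in> T \<Longrightarrow> y \<in> T \<Longrightarrow> f x < f y \<Longrightarrow> g y < g x"
    and "\<And>x y. x \<in> T \<Longrightarrow> y \<in> T \<Longrightarrow> f x < g y"
  shows "is_stack T"
proof -
  obtain xs where xs: "set xs = T" "length xs = card T" "sorted_wrt (\<lambda>x y. f x < f y) xs"
    using obtain_sorted_list[OF assms(1,2)] by blast
  have "sorted_wrt (\<lambda>x y. g y < g x) xs"
    using xs(1) assms(4) by (intro sorted_wrt_mono_rel[OF _ xs(3)]) auto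
  then have "sorted_wrt (<) (map f xs @ rev (map g xs))"
    using xs assms(5) by (simp add: sorted_wrt_append sorted_wrt_map sorted_wrt_rev)
  moreover have "(\<lambda>e. {f e, g e}) ` set xs = T"
    using assms(3) unfolding xs(1) by force
  ultimately show ?thesis
    unfolding is_stack_def
    by (intro exI[of _ "length xs"] exI[of _ "\<lambda>i. f (xs ! (i - 1))"] exI[of _ "\<lambda>i. g (xs ! (i - 1))"])
      (simp only: map_nth_upt_Suc image_nth_upt_Suc[of "\<lambda>e. {f e, g e}"])
qed

section \<open>Edges joining the two halves\<close>

text \<open>All potential edges between the halves, independent of a matching; those present in
  \<open>M\<close> are \<open>M \<inter> cross_edges n\<close>. \<open>Min\<close> and
  \<open>Max\<close> of such an edge are its ends in the lower and the upper half.\<close>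

definition cross_edges :: "nat \<Rightarrow> nat set set" where
  "cross_edges n = (\<lambda>(a, b). {a, b}) ` ({1..n} \<times> {n + 1..2 * n})"

lemma cross_edgesE:
  assumes "e \<in> cross_edges n"
  obtains a b where "e = {a, b}" "a \<in> {1..n}" "b \<in> {n + 1..2 * n}"
  using assms by (auto simp: cross_edges_def)

lemma card_cross_edges: "card (cross_edges n) = n ^ 2"
proof -
  have "inj_on (\<lambda>(a, b). {a, b}) ({1..n} \<times> {n + 1..2 * n})"
    by (auto simp: inj_on_def doubleton_eq_iff)
  then show ?thesis
    unfolding cross_edges_def by (simp add: card_image power2_eq_square)
qed

lemma finite_cross_edges: "finite (cross_edges n)"
  by (simp add: cross_edges_def)

text \<open>Sending left ends to right ends, the edges across the middle form a permutation pattern: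
  increasing sets are waves and decreasing sets are stacks. The hypotheses exclude one exact size
  each, which is the form that the first-moment bound provides.\<close>

lemma card_cross_edges_le_if_no_wave_no_stack:
  assumes M: "M \<in> perfect_matchings V"
    and wave: "\<And>T. T \<subseteq> M \<Longrightarrow> is_wave T \<Longrightarrow> card T \<noteq> Suc s"
    and stack: "\<And>T. T \<subseteq> M \<Longrightarrow> is_stack T \<Longrightarrow> card T \<noteq> Suc t"
  shows "card (M \<inter> cross_edges n) \<le> s * t"
proof (rule Erdos_Szekeres)
  let ?C = "M \<inter> cross_edges n"
  have ends: "e = {Min e, Max e} \<and> Min e \<le> n \<and> n < Max e" if e: "e \<in> ?C" for e
  proof -
    from e have "e \<in> cross_edges n" by simp
    then obtain a b where ab: "e = {a, b}" "a \<le> n" "n < b" by (elim cross_edgesE) auto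
    then have "Min e = a" "Max e = b" by simp_all
    then show ?thesis using ab by simp
  qed
  have "pairwise disjnt M" using M by (simp add: perfect_matchings_def)
  then have disj: "x = y" if "x \<in> ?C" "y \<in> ?C" "x \<inter> y \<noteq> {}" for x y
    using pairwiseD[of disjnt M x y] that by (auto simp: disjnt_def)
  show inj: "inj_on Min ?C"
    by (rule inj_onI) (metis disj disjoint_iff ends insertI1)
  show "inj_on Max ?C"
    by (rule inj_onI) (metis disj disjoint_iff ends insertCI)
  show "finite ?C" by (simp add: finite_cross_edges)
  fix T assume T: "T \<subseteq> ?C"
  have sub: "finite U" "inj_on Min U" "\<And>e. e \<in> U \<Longrightarrow> e = {Min e, Max e}"
    "\<And>x y. x \<in> U \<Longrightarrow> y \<in> U \<Longrightarrow> Min x < Max y" if U: "U \<subseteq> ?C" for U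
  proof -
    show "finite U" using U finite_cross_edges finite_subset by blast
    show "inj_on Min U" using inj U by (rule inj_on_subset)
    show "e = {Min e, Max e}" if "e \<in> U" for e using ends U that by blast
    show "Min x < Max y" if "x \<in> U" "y \<in> U" for x y
      using ends[of x] ends[of y] U that by (meson le_less_trans subsetD)
  qed
  show "card T \<le> s" if incr: "\<And>x y. x \<in> T \<Longrightarrow> y \<in> T \<Longrightarrow> Min x < Min y \<Longrightarrow> Max x < Max y"
  proof (rule ccontr)
    assume "\<not> card T \<le> s"
    then have "Suc s \<le> card T" by simp
    \<comment> \<open>A larger increasing set is cut down to the excluded size; subsets stay
      increasing.\<close>
    then obtain U where U: "U \<subseteq> T" "card U = Suc s" by (rule obtain_subset_with_card_n)
    then have UC: "U \<subseteq> ?C" using T by blast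
    have "is_wave U"
      by (rule is_wave_of_increasing[OF sub(1,2)[OF UC] sub(3)[OF UC] _ sub(4)[OF UC]])
        (use incr U(1) in auto)
    then show False using wave[of U] U UC by auto
  qed
  show "card T \<le> t" if decr: "\<And>x y. x \<in> T \<Longrightarrow> y \<in> T \<Longrightarrow> Min x < Min y \<Longrightarrow> Max y < Max x"
  proof (rule ccontr)
    assume "\<not> card T \<le> t"
    then have "Suc t \<le> card T" by simp
    then obtain U where U: "U \<subseteq> T" "card U = Suc t" by (rule obtain_subset_with_card_n)
    then have UC: "U \<subseteq> ?C" using T by blast
    have "is_stack U"
      by (rule is_stack_of_decreasing[OF sub(1,2)[OF UC] sub(3)[OF UC] _ sub(4)[OF UC]])
        (use decr U(1) in auto)
    then show False using stack[of U] U UC by auto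
  qed
qed

text \<open>Excluding the size \<open>nat \<lceil>q\<rceil>\<close> bounds monotone sets by a number
  strictly below \<open>q\<close>; this strictness gives the contradiction in the next two lemmas.
  Positivity of \<open>q\<close> prevents truncated subtraction.\<close>

lemma pred_nat_ceiling:
  fixes q :: real
  assumes "q > 0"
  shows "Suc (nat \<lceil>q\<rceil> - 1) = nat \<lceil>q\<rceil>" "real (nat \<lceil>q\<rceil> - 1) < q"
  using assms by linarith+

text \<open>If waves were also smaller than \<open>q\<close>, there would be at most
  \<open>(\<lceil>q\<rceil> - 1) * (\<lceil>p\<rceil> - 1) < q * p\<close> edges across the
  middle.\<close>

lemma ex_large_wave_if_no_stack:
  fixes p q :: real
  assumes "M \<in> perfect_matchings V" "p > 0" "q > 0" "q * p \<le> card (M \<inter> cross_edges n)"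
    and "\<And>T. T \<subseteq> M \<Longrightarrow> is_stack T \<Longrightarrow> card T \<noteq> nat \<lceil>p\<rceil>"
  shows "\<exists>W\<subseteq>M. is_wave W \<and> real (card W) \<ge> q"
proof (rule ccontr)
  assume "\<not> ?thesis"
  then have "card T \<noteq> nat \<lceil>q\<rceil>" if "T \<subseteq> M" "is_wave T" for T
    using that real_nat_ceiling_ge[of q] by metis
  then have "card (M \<inter> cross_edges n) \<le> (nat \<lceil>q\<rceil> - 1) * (nat \<lceil>p\<rceil> - 1)"
    using assms(5) pred_nat_ceiling(1)[OF \<open>p > 0\<close>] pred_nat_ceiling(1)[OF \<open>q > 0\<close>]
    by (intro card_cross_edges_le_if_no_wave_no_stack[OF assms(1)]) auto
  then have "real (card (M \<inter> cross_edges n)) \<le> real (nat \<lceil>q\<rceil> - 1) * real (nat \<lceil>p\<rceil> - 1)"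
    by (metis of_nat_le_iff of_nat_mult)
  also have "\<dots> < q * p"
    using pred_nat_ceiling(2)[OF \<open>p > 0\<close>] pred_nat_ceiling(2)[OF \<open>q > 0\<close>]
    by (intro mult_strict_mono') auto
  finally show False using assms(4) by simp
qed

lemma ex_large_stack_if_no_wave:
  fixes p q :: real
  assumes "M \<in> perfect_matchings V" "p > 0" "q > 0" "q * p \<le> card (M \<inter> cross_edges n)"
    and "\<And>T. T \<subseteq> M \<Longrightarrow> is_wave T \<Longrightarrow> card T \<noteq> nat \<lceil>p\<rceil>"
  shows "\<exists>W\<subseteq>M. is_stack W \<and> real (card W) \<ge> q"
proof (rule ccontr)
  assume "\<not> ?thesis"
  then have "card T \<noteq> nat \<lceil>q\<rceil>" if "T \<subseteq> M" "is_stack T" for T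
    using that real_nat_ceiling_ge[of q] by metis
  then have "card (M \<inter> cross_edges n) \<le> (nat \<lceil>p\<rceil> - 1) * (nat \<lceil>q\<rceil> - 1)"
    using assms(5) pred_nat_ceiling(1)[OF \<open>p > 0\<close>] pred_nat_ceiling(1)[OF \<open>q > 0\<close>]
    by (intro card_cross_edges_le_if_no_wave_no_stack[OF assms(1)]) auto
  then have "real (card (M \<inter> cross_edges n)) \<le> real (nat \<lceil>q\<rceil> - 1) * real (nat \<lceil>p\<rceil> - 1)"
    by (metis mult.commute of_nat_le_iff of_nat_mult)
  also have "\<dots> < q * p"
    using pred_nat_ceiling(2)[OF \<open>p > 0\<close>] pred_nat_ceiling(2)[OF \<open>q > 0\<close>]
    by (intro mult_strict_mono') auto
  finally show False using assms(4) by simp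
qed

section \<open>Moments of the number of edges across the middle\<close>

text \<open>A prescribed edge leaves \<open>2 * (n - 1)\<close> free vertices and two disjoint ones
  leave \<open>2 * (n - 2)\<close>; distinct edges with a common vertex exclude each other.\<close>

lemma card_matchings_containing_edges:
  assumes "finite V" "card V = 2 * n" "e \<in> cross_edges m" "e \<subseteq> V"
  shows "card {M \<in> perfect_matchings V. e \<in> M} = odd_fact (n - 1)"
    and "\<lbrakk>f \<in> cross_edges m; f \<subseteq> V; f \<noteq> e\<rbrakk> \<Longrightarrow>
      card {M \<in> perfect_matchings V. e \<in> M \<and> f \<in> M} = (if disjnt e f then odd_fact (n - 2) else 0)"
proof -
  have two: "{g} \<in> perfect_matchings g" "card g = 2" if g: "g \<in> cross_edges m" for g
  proof -
    obtain a b where "g = {a, b}" "a \<noteq> b" using g by (elim cross_edgesE) auto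
    then show "{g} \<in> perfect_matchings g" "card g = 2"
      using singleton_perfect_matchings[of a b] by auto
  qed
  have "card (V - e) = 2 * (n - 1)"
    using assms two[OF assms(3)] by (simp add: card_Diff_subset finite_subset)
  then show "card {M \<in> perfect_matchings V. e \<in> M} = odd_fact (n - 1)"
    using card_perfect_matchings_supset[OF two(1)[OF assms(3)] assms(4)] assms(1)
    by (simp add: card_perfect_matchings)
  assume f: "f \<in> cross_edges m" "f \<subseteq> V" "f \<noteq> e"
  show "card {M \<in> perfect_matchings V. e \<in> M \<and> f \<in> M} = (if disjnt e f then odd_fact (n - 2) else 0)"
  proof (cases "disjnt e f")
    case True
    then have ef: "{e} \<union> {f} \<in> perfect_matchings (e \<union> f)"
      using two(1)[OF assms(3)] two(1)[OF f(1)]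
      by (intro perfect_matchings_disjoint_Un) (auto simp: disjnt_def)
    have "finite e" "finite f" using assms f by (auto intro: finite_subset)
    then have "card (e \<union> f) = 4"
      using True two(2)[OF assms(3)] two(2)[OF f(1)] by (simp add: card_Un_disjnt)
    then have "card (V - (e \<union> f)) = 2 * (n - 2)"
      using assms f \<open>finite e\<close> \<open>finite f\<close> by (simp add: card_Diff_subset)
    then show ?thesis
      using card_perfect_matchings_supset[OF ef, of V] assms f True
      by (simp add: card_perfect_matchings conj_commute)
  next
    case False
    then have "{M \<in> perfect_matchings V. e \<in> M \<and> f \<in> M} = {}"
      using f(3) by (auto simp: perfect_matchings_def pairwise_def)
    then show ?thesis using False by (simp only: card.empty if_False)
  qed
qed

lemma card_disjoint_cross_edges:
  assumes "e \<in> cross_edges n"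
  shows "card {f \<in> cross_edges n. disjnt e f} \<le> (n - 1) ^ 2"
proof -
  obtain a b where e: "e = {a, b}" "a \<in> {1..n}" "b \<in> {n + 1..2 * n}"
    using assms by (rule cross_edgesE)
  let ?A = "({1..n} - {a}) \<times> ({n + 1..2 * n} - {b})"
  have "{f \<in> cross_edges n. disjnt e f} \<subseteq> (\<lambda>(x, y). {x, y}) ` ?A"
    unfolding cross_edges_def e(1) by (auto simp: disjnt_def)
  then have "card {f \<in> cross_edges n. disjnt e f} \<le> card ((\<lambda>(x, y). {x, y}) ` ?A)"
    by (intro card_mono) auto
  also have "\<dots> \<le> card ?A" by (intro card_image_le) auto
  also have "\<dots> = (n - 1) ^ 2" using e by (simp add: power2_eq_square)
  finally show ?thesis .
qed

text \<open>Double counting with indicators of the \<open>n ^ 2\<close> possible edges. In the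
  second moment a pair of equal edges contributes \<open>odd_fact (n - 1)\<close>, and each edge has
  at most \<open>(n - 1) ^ 2\<close> disjoint partners, contributing \<open>odd_fact (n - 2)\<close>
  each.\<close>

lemma sum_card_cross_edges:
  shows "(\<Sum>M\<in>perfect_matchings {1..2 * n}. card (M \<inter> cross_edges n)) = n ^ 2 * odd_fact (n - 1)" (is ?first)
  and "(\<Sum>M\<in>perfect_matchings {1..2 * n}. card (M \<inter> cross_edges n) ^ 2) \<le>
    n ^ 2 * (odd_fact (n - 1) + (n - 1) ^ 2 * odd_fact (n - 2))" (is ?second)
proof -
  let ?K = "cross_edges n" and ?P = "perfect_matchings {1..2 * n}"
  have sub: "e \<subseteq> {1..2 * n}" if "e \<in> ?K" for e
    using that by (auto simp: cross_edges_def)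
  have V: "finite {1..2 * n}" "card {1..2 * n} = 2 * n" by simp_all
  have fin: "finite ?P" by (simp add: finite_perfect_matchings)
  have X: "card (M \<inter> ?K) = (\<Sum>e\<in>?K. of_bool (e \<in> M))" for M
    by (simp add: finite_cross_edges Int_commute)
  have "(\<Sum>M\<in>?P. card (M \<inter> ?K)) = (\<Sum>e\<in>?K. \<Sum>M\<in>?P. of_bool (e \<in> M))"
    unfolding X by (rule sum.swap)
  also have "\<dots> = (\<Sum>e\<in>?K. odd_fact (n - 1))"
  proof (rule sum.cong)
    fix e assume e: "e \<in> ?K"
    show "(\<Sum>M\<in>?P. of_bool (e \<in> M)) = odd_fact (n - 1)"
      using card_matchings_containing_edges(1)[OF V e sub[OF e]] fin
      by (simp add: Int_def)
  qed simp
  finally show ?first by (simp add: card_cross_edges)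
  have "(\<Sum>M\<in>?P. card (M \<inter> ?K) ^ 2) =
      (\<Sum>M\<in>?P. \<Sum>e\<in>?K. \<Sum>f\<in>?K. of_bool (e \<in> M \<and> f \<in> M))"
    unfolding X power2_eq_square sum_product by (simp only: of_bool_conj)
  also have "\<dots> = (\<Sum>e\<in>?K. \<Sum>f\<in>?K. \<Sum>M\<in>?P. of_bool (e \<in> M \<and> f \<in> M))"
    by (subst sum.swap, intro sum.cong refl, subst sum.swap) simp
  also have "\<dots> = (\<Sum>e\<in>?K. \<Sum>f\<in>?K. card {M \<in> ?P. e \<in> M \<and> f \<in> M})"
    using fin by (simp add: Int_def)
  also have "\<dots> \<le> (\<Sum>e\<in>?K. odd_fact (n - 1) + (n - 1) ^ 2 * odd_fact (n - 2))"
  proof (rule sum_mono)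
    fix e assume e: "e \<in> ?K"
    have "(\<Sum>f\<in>?K. card {M \<in> ?P. e \<in> M \<and> f \<in> M}) =
        card {M \<in> ?P. e \<in> M} + (\<Sum>f\<in>?K - {e}. card {M \<in> ?P. e \<in> M \<and> f \<in> M})"
      using e by (subst sum.remove[OF finite_cross_edges e]) simp
    also have "card {M \<in> ?P. e \<in> M} = odd_fact (n - 1)"
      using card_matchings_containing_edges(1)[OF V e sub[OF e]] .
    also have "(\<Sum>f\<in>?K - {e}. card {M \<in> ?P. e \<in> M \<and> f \<in> M}) =
        (\<Sum>f\<in>?K - {e}. if disjnt e f then odd_fact (n - 2) else 0)"
      using card_matchings_containing_edges(2)[OF V e sub[OF e]] sub by (intro sum.cong) auto
    also have "\<dots> \<le> (\<Sum>f\<in>?K. if disjnt e f then odd_fact (n - 2) else 0)"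
      by (intro sum_mono2) (auto simp: finite_cross_edges)
    also have "\<dots> = card {f \<in> ?K. disjnt e f} * odd_fact (n - 2)"
      by (simp add: sum.If_cases finite_cross_edges Int_def)
    also have "\<dots> \<le> (n - 1) ^ 2 * odd_fact (n - 2)"
      using card_disjoint_cross_edges[OF e] by (rule mult_right_mono) simp
    finally show "(\<Sum>f\<in>?K. card {M \<in> ?P. e \<in> M \<and> f \<in> M}) \<le>
        odd_fact (n - 1) + (n - 1) ^ 2 * odd_fact (n - 2)" by simp
  qed
  finally show ?second by (simp add: card_cross_edges)
qed

text \<open>Chebyshev's inequality: the mean \<open>n ^ 2 / (2 * n - 1)\<close> is at least
  \<open>n / 2\<close>, and the variance is at most \<open>n\<close>.\<close>

lemma card_few_cross_edges_le:
  assumes "n \<ge> 2" "c > 0"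
  shows "real (card {M \<in> perfect_matchings {1..2 * n}. card (M \<inter> cross_edges n) < n / 2 - c}) \<le>
    n / c ^ 2 * odd_fact n"
proof -
  let ?P = "perfect_matchings {1..2 * n}"
  let ?B = "{M \<in> ?P. card (M \<inter> cross_edges n) < n / 2 - c}"
  obtain m where m: "n = m + 2" using assms(1) by (metis le_add_diff_inverse2)
  define X where "X M = real (card (M \<inter> cross_edges n))" for M
  define w where "w = real (odd_fact m)"
  define r where "r = real m"
  \<comment> \<open>The mean \<open>n ^ 2 * odd_fact (n - 1) / odd_fact n\<close>, written with
    \<open>n = r + 2\<close>.\<close>
  define \<mu> where "\<mu> = (r + 2) ^ 2 / (2 * r + 3)"
  have r: "r \<ge> 0" "real n = r + 2" by (simp_all add: r_def m)
  have w: "w > 0" by (simp add: w_def odd_fact_pos)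
  have odd1: "real (odd_fact (n - 1)) = (2 * r + 1) * w"
    and odd2: "real (odd_fact (n - 2)) = w"
    and odd0: "real (odd_fact n) = (2 * r + 3) * ((2 * r + 1) * w)"
    unfolding m w_def r_def by (simp_all add: odd_fact_Suc algebra_simps numeral_2_eq_2)
  have s0: "(\<Sum>M\<in>?P. 1 :: real) = (2 * r + 3) * ((2 * r + 1) * w)"
    using odd0 by (simp add: card_perfect_matchings)
  have s1: "(\<Sum>M\<in>?P. X M) = (r + 2) ^ 2 * ((2 * r + 1) * w)"
    using arg_cong[OF sum_card_cross_edges(1)[of n], of real] r odd1 by (simp add: X_def)
  have s2: "(\<Sum>M\<in>?P. X M ^ 2) \<le> (r + 2) ^ 2 * ((2 * r + 1) * w + (r + 1) ^ 2 * w)"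
  proof -
    have "(\<Sum>M\<in>?P. X M ^ 2) = real (\<Sum>M\<in>?P. card (M \<inter> cross_edges n) ^ 2)"
      by (simp add: X_def)
    also have "\<dots> \<le> real (n ^ 2 * (odd_fact (n - 1) + (n - 1) ^ 2 * odd_fact (n - 2)))"
      by (intro of_nat_mono sum_card_cross_edges(2))
    also have "\<dots> = (r + 2) ^ 2 * ((2 * r + 1) * w + (r + 1) ^ 2 * w)"
      using r odd1 odd2 by (simp add: m r_def add_ac)
    finally show ?thesis .
  qed
  have "(\<Sum>M\<in>?P. (X M - \<mu>) ^ 2) =
      (\<Sum>M\<in>?P. X M ^ 2) - 2 * \<mu> * (\<Sum>M\<in>?P. X M) + \<mu> ^ 2 * (\<Sum>M\<in>?P. 1)"
    by (simp add: power2_diff sum.distrib sum_subtractf sum_distrib_left mult_ac)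
  also have "\<dots> \<le> (r + 2) ^ 2 * ((2 * r + 1) * w + (r + 1) ^ 2 * w) -
      2 * \<mu> * ((r + 2) ^ 2 * ((2 * r + 1) * w)) + \<mu> ^ 2 * ((2 * r + 3) * ((2 * r + 1) * w))"
    unfolding s0 s1 using s2 by simp
  also have "\<dots> = w * ((r + 2) ^ 2 * (2 * r + 1) + (r + 2) ^ 2 * ((r + 1) ^ 2 - \<mu> * (2 * r + 1)))"
  proof -
    have "(r + 2) ^ 2 = \<mu> * (2 * r + 3)" using r by (simp add: \<mu>_def)
    then show ?thesis by algebra
  qed
  also have "\<dots> \<le> w * ((r + 2) * (2 * r + 3) * (2 * r + 1))"
  proof -
    \<comment> \<open>In terms of \<open>n\<close> this is
      \<open>(n - 1) ^ 2 / (2 * n - 3) \<le> \<mu>\<close>: pairs of disjoint edges contribute at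
      most \<open>\<mu> ^ 2\<close> to the second moment, so the variance is bounded by the
      contribution of equal pairs.\<close>
    have "(r + 1) ^ 2 * (2 * r + 3) \<le> (r + 2) ^ 2 * (2 * r + 1)"
      using r by (simp add: power2_eq_square algebra_simps)
    then have "(r + 1) ^ 2 \<le> \<mu> * (2 * r + 1)"
      using r by (simp add: \<mu>_def field_simps)
    then have "(r + 2) ^ 2 * ((r + 1) ^ 2 - \<mu> * (2 * r + 1)) \<le> 0"
      by (intro mult_nonneg_nonpos) auto
    moreover have "(r + 2) ^ 2 * (2 * r + 1) \<le> (r + 2) * (2 * r + 3) * (2 * r + 1)"
      using r unfolding power2_eq_square by (intro mult_right_mono mult_left_mono) auto
    ultimately show ?thesis using w by (intro mult_left_mono) auto
  qed
  also have "\<dots> = real n * odd_fact n" unfolding odd0 r(2) by (simp add: mult_ac)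
  finally have var: "(\<Sum>M\<in>?P. (X M - \<mu>) ^ 2) \<le> real n * odd_fact n" .
  have mu: "\<mu> \<ge> n / 2"
    using r by (simp add: \<mu>_def field_simps power2_eq_square)
  have "real (card ?B) * c ^ 2 = (\<Sum>M\<in>?B. c ^ 2)" by simp
  also have "\<dots> \<le> (\<Sum>M\<in>?B. (X M - \<mu>) ^ 2)"
  proof (rule sum_mono)
    fix M assume "M \<in> ?B"
    then have "c \<le> \<mu> - X M" using mu by (simp add: X_def)
    then have "c ^ 2 \<le> (\<mu> - X M) ^ 2" using assms(2) by (intro power_mono) auto
    then show "c ^ 2 \<le> (X M - \<mu>) ^ 2" by (simp add: power2_commute)
  qed
  also have "\<dots> \<le> (\<Sum>M\<in>?P. (X M - \<mu>) ^ 2)"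
    by (intro sum_mono2 finite_perfect_matchings) auto
  also note var
  finally show ?thesis using assms(2) by (simp add: field_simps)
qed

section \<open>Choice of parameters and conclusion\<close>

text \<open>At this size the base of the first-moment bound is at most
  \<open>1 / (1 + \<delta>)\<close>. Bernoulli's inequality bounds its \<open>k\<close>-th power by
  \<open>1 / (1 + k * \<delta>)\<close>, and
  \<open>k * \<delta> \<ge> sqrt n * \<delta> = n powr (1 / 4)\<close>.\<close>

lemma card_large_pattern_le:
  assumes "inj_on Union {F. P F}" "n \<ge> 1" and \<delta>: "\<delta> = real n powr (- 1 / 4)"
  shows "real (card {M \<in> perfect_matchings {1..2 * n}.
      \<exists>F\<subseteq>M. P F \<and> card F = nat \<lceil>(1 + \<delta>) * (exp 1 * sqrt (n / 2))\<rceil>})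
    \<le> 1 / (1 + real n powr (1 / 4)) * odd_fact n"
proof -
  define K where "K = (1 + \<delta>) * (exp 1 * sqrt (n / 2))"
  define k where "k = nat \<lceil>K\<rceil>"
  have \<delta>_pos: "\<delta> > 0" using assms(2) unfolding \<delta> by simp
  have K_pos: "K > 0" unfolding K_def using assms(2) \<delta>_pos by simp
  have k: "k \<ge> 1" "real k \<ge> K" unfolding k_def using K_pos by linarith+
  have "K ^ 2 \<le> real k ^ 2" using k(2) K_pos by (intro power_mono) auto
  moreover have "2 * K ^ 2 = (1 + \<delta>) ^ 2 * (exp 1 ^ 2 * n)"
    by (simp add: K_def power_mult_distrib)
  ultimately have le: "(1 + \<delta>) ^ 2 * (exp 1 ^ 2 * n) \<le> 2 * real k ^ 2" by linarith
  have "(1 + \<delta>) * (exp 1 ^ 2 * n) \<le> (1 + \<delta>) ^ 2 * (exp 1 ^ 2 * n)"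
    using \<delta>_pos by (intro mult_right_mono) (auto simp: power2_eq_square)
  then have base: "exp 1 ^ 2 * n / (2 * real k ^ 2) \<le> 1 / (1 + \<delta>)"
    using le k(1) \<delta>_pos by (simp add: field_simps)
  have "real n powr (1 / 4) = \<delta> * sqrt n"
    unfolding \<delta> using assms(2) by (simp add: powr_half_sqrt[symmetric] powr_add[symmetric])
  also have "\<dots> \<le> \<delta> * real k"
  proof -
    have "sqrt 2 \<le> sqrt (2\<^sup>2)" by (intro real_sqrt_le_mono) simp
    also have "\<dots> \<le> exp 1" using exp_ge_add_one_self[of 1] by simp
    finally have "1 \<le> exp 1 / sqrt 2" by simp
    then have "1 * sqrt n \<le> exp 1 / sqrt 2 * sqrt n" by (intro mult_right_mono) auto
    also have "\<dots> = exp 1 * sqrt (n / 2)" by (simp add: real_sqrt_divide)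
    also have "\<dots> \<le> K"
      unfolding K_def using \<delta>_pos mult_right_mono[of 1 "1 + \<delta>" "exp 1 * sqrt (n / 2)"] by simp
    finally show ?thesis using k(2) \<delta>_pos by (intro mult_left_mono) auto
  qed
  finally have "1 + real n powr (1 / 4) \<le> 1 + real k * \<delta>" by (simp add: mult.commute)
  also have "\<dots> \<le> (1 + \<delta>) ^ k" using \<delta>_pos by (intro Bernoulli_inequality) simp
  finally have bern: "1 + real n powr (1 / 4) \<le> (1 + \<delta>) ^ k" .
  have "real (card {M \<in> perfect_matchings {1..2 * n}. \<exists>F\<subseteq>M. P F \<and> card F = k})
      \<le> real ((2 * n choose (2 * k)) * odd_fact (n - k))"
    by (intro of_nat_mono card_containing_pattern_le assms(1)) auto
  also have "\<dots> \<le> (exp 1 ^ 2 * n / (2 * real k ^ 2)) ^ k * odd_fact n"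
    using k(1) by (rule expected_number_le)
  also have "\<dots> \<le> (1 / (1 + \<delta>)) ^ k * odd_fact n"
    using base by (intro mult_right_mono power_mono) auto
  also have "\<dots> \<le> 1 / (1 + real n powr (1 / 4)) * odd_fact n"
    using bern \<delta>_pos by (intro mult_right_mono)
      (auto simp: power_divide intro!: divide_left_mono mult_pos_pos add_pos_nonneg)
  finally show ?thesis unfolding k_def K_def .
qed

theorem theorem12:
  shows "\<exists>\<epsilon> :: nat \<Rightarrow> real. \<epsilon> \<longlonglongrightarrow> 0 \<and>
    (\<lambda>n. measure_pmf.prob (RM n)
       {M. (\<exists>S\<subseteq>M. is_stack S \<and> real (card S) \<ge> (1 - \<epsilon> n) / (exp 1 * sqrt 2) * sqrt (real n)) \<and>
           (\<exists>W\<subseteq>M. is_wave W \<and> real (card W) \<ge> (1 - \<epsilon> n) / (exp 1 * sqrt 2) * sqrt (real n)) \<and>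
           (\<exists>L\<subseteq>M. is_line L \<and> real (card L) \<ge> 1 / 8 * sqrt (real n))}) \<longlonglongrightarrow> 1"
proof -
  define \<delta> where "\<delta> n = real n powr (- 1 / 4)" for n
  \<comment> \<open>Chosen so that \<open>q n * p n\<close> is exactly
    \<open>n / 2 - n powr (3 / 4)\<close>, the number of edges across the middle that Chebyshev's
    inequality guarantees; note that \<open>\<delta> n * n = n powr (3 / 4)\<close>.\<close>
  define \<epsilon> where "\<epsilon> n = 1 - (1 - 2 * \<delta> n) / (1 + \<delta> n)" for n
  define q where "q n = (1 - \<epsilon> n) / (exp 1 * sqrt 2) * sqrt (real n)" for n
  define p where "p n = (1 + \<delta> n) * (exp 1 * sqrt (n / 2))" for n
  define good where "good n = {M :: nat set set. (\<exists>S\<subseteq>M. is_stack S \<and> real (card S) \<ge> q n) \<and>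
    (\<exists>W\<subseteq>M. is_wave W \<and> real (card W) \<ge> q n) \<and>
    (\<exists>L\<subseteq>M. is_line L \<and> real (card L) \<ge> 1 / 8 * sqrt (real n))}" for n
  \<comment> \<open>The terms bound the failure probabilities for the edges across the middle, for
    oversized stacks and waves together, and for the lines.\<close>
  define err where "err n = 1 / sqrt n + 2 / (1 + real n powr (1 / 4)) +
    4 / 3 * (81 / 128) powr (1 / 8 * sqrt n)" for n
  have "\<epsilon> \<longlonglongrightarrow> 0" unfolding \<epsilon>_def \<delta>_def by real_asymp
  have err0: "(\<lambda>n. 1 - err n) \<longlonglongrightarrow> 1" unfolding err_def by real_asymp
  have bound: "1 - err n \<le> measure_pmf.prob (RM n) (good n)" if n: "n \<ge> 36" for n
  proof -
    let ?P = "perfect_matchings {1..2 * n}"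
    let ?c = "real n powr (3 / 4)"
    let ?B1 = "{M \<in> ?P. card (M \<inter> cross_edges n) < n / 2 - ?c}"
    let ?B2 = "{M \<in> ?P. \<exists>F\<subseteq>M. is_stack F \<and> card F = nat \<lceil>p n\<rceil>}"
    let ?B3 = "{M \<in> ?P. \<exists>F\<subseteq>M. is_wave F \<and> card F = nat \<lceil>p n\<rceil>}"
    let ?B4 = "{M \<in> ?P. max_line M < 1 / 8 * sqrt n}"
    have \<delta>_pos: "\<delta> n > 0" using n by (simp add: \<delta>_def)
    \<comment> \<open>This makes \<open>1 - 2 * \<delta> n\<close>, and with it \<open>q n\<close>,
      positive; it holds since \<open>n > 16\<close>.\<close>
    have "\<delta> n < 1 / 2"
    proof -
      have "(16 :: real) powr (1 / 4) < real n powr (1 / 4)"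
        using n by (intro powr_less_mono2) auto
      moreover have "(16 :: real) powr (1 / 4) = (2 powr 4) powr (1 / 4)" by (simp add: powr_numeral)
      ultimately have "2 < real n powr (1 / 4)" by (simp only: powr_powr) simp
      then show ?thesis by (simp add: \<delta>_def powr_minus_divide divide_less_eq)
    qed
    then have q_pos: "q n > 0" using n \<delta>_pos by (simp add: q_def \<epsilon>_def)
    have p_pos: "p n > 0" using n \<delta>_pos by (simp add: p_def)
    have "x / y / (e * t) * s * (y * (e * (s / t))) = x * (s ^ 2 / t ^ 2)"
      if "y \<noteq> 0" "e \<noteq> 0" "t \<noteq> 0" for x y e s t :: real
      using that by (simp add: field_simps power2_eq_square)
    from this[of "1 + \<delta> n" "exp 1" "sqrt 2" "1 - 2 * \<delta> n" "sqrt n"]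
    have "q n * p n = (1 - 2 * \<delta> n) * (n / 2)"
      using \<delta>_pos by (simp add: q_def p_def \<epsilon>_def real_sqrt_divide)
    also have "\<dots> = n / 2 - \<delta> n * n" by (simp add: field_simps)
    also have "\<delta> n * n = ?c"
      using n powr_add[of "real n" "- 1 / 4" 1] by (simp add: \<delta>_def)
    finally have qp: "q n * p n = n / 2 - ?c" .
    have "M \<in> good n" if "M \<in> ?P" "M \<notin> ?B1" "M \<notin> ?B2" "M \<notin> ?B3" "M \<notin> ?B4" for M
    proof -
      have cross: "q n * p n \<le> card (M \<inter> cross_edges n)" using that qp by simp
      \<comment> \<open>The bounds cross over: the absence of stacks of size
        \<open>nat \<lceil>p n\<rceil>\<close> forces a large wave, and the absence of waves of that
        size forces a large stack.\<close>
      have "\<exists>W\<subseteq>M. is_wave W \<and> real (card W) \<ge> q n"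
        using that(1,3) by (intro ex_large_wave_if_no_stack[OF that(1) p_pos q_pos cross]) auto
      moreover have "\<exists>S\<subseteq>M. is_stack S \<and> real (card S) \<ge> q n"
        using that(1,4) by (intro ex_large_stack_if_no_wave[OF that(1) p_pos q_pos cross]) auto
      moreover have "finite M" using finite_perfect_matching[OF _ that(1)] by simp
      then obtain L where "L \<subseteq> M" "is_line L" "card L = max_line M" by (rule max_line_attained)
      moreover have "max_line M \<ge> 1 / 8 * sqrt n" using that(1,5) by simp
      ultimately show ?thesis unfolding good_def by auto
    qed
    then have "{M \<in> ?P. M \<notin> good n} \<subseteq> ?B1 \<union> ?B2 \<union> ?B3 \<union> ?B4" by blast
    then have "card {M \<in> ?P. M \<notin> good n} \<le> card (?B1 \<union> ?B2 \<union> ?B3 \<union> ?B4)"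
      by (intro card_mono) (auto simp: finite_perfect_matchings)
    also have "\<dots> \<le> card ?B1 + card ?B2 + card ?B3 + card ?B4"
      by (meson add_mono card_Un_le order_refl order_trans)
    finally have "real (card {M \<in> ?P. M \<notin> good n}) \<le>
        real (card ?B1) + real (card ?B2) + real (card ?B3) + real (card ?B4)"
      by linarith
    also have "\<dots> \<le> 1 / sqrt n * odd_fact n + 1 / (1 + real n powr (1 / 4)) * odd_fact n +
        1 / (1 + real n powr (1 / 4)) * odd_fact n +
        4 / 3 * (81 / 128) powr (1 / 8 * sqrt n) * odd_fact n"
    proof (intro add_mono)
      have "real (card ?B1) \<le> n / ?c ^ 2 * odd_fact n"
        using n by (intro card_few_cross_edges_le) auto
      also have "?c ^ 2 = real n powr (3 / 2)"
        using n by (simp add: powr_power)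
      also have "n / real n powr (3 / 2) = 1 / sqrt n"
        using n powr_diff[of "real n" 1 "3 / 2"]
        by (simp add: powr_minus_divide powr_half_sqrt[symmetric])
      finally show "real (card ?B1) \<le> 1 / sqrt n * odd_fact n" .
      show "real (card ?B2) \<le> 1 / (1 + real n powr (1 / 4)) * odd_fact n"
        unfolding p_def using n
        by (intro card_large_pattern_le stack_determined_by_vertices) (auto simp: \<delta>_def)
      show "real (card ?B3) \<le> 1 / (1 + real n powr (1 / 4)) * odd_fact n"
        unfolding p_def using n
        by (intro card_large_pattern_le wave_determined_by_vertices) (auto simp: \<delta>_def)
      show "real (card ?B4) \<le> 4 / 3 * (81 / 128) powr (1 / 8 * sqrt n) * odd_fact n"
        using n by (rule card_short_max_line_le)
    qed
    also have "\<dots> = err n * odd_fact n" by (simp add: err_def algebra_simps)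
    finally have bad: "real (card {M \<in> ?P. M \<notin> good n}) \<le> err n * odd_fact n" .
    have "?P = {M \<in> ?P. M \<in> good n} \<union> {M \<in> ?P. M \<notin> good n}" by blast
    then have "card ?P = card {M \<in> ?P. M \<in> good n} + card {M \<in> ?P. M \<notin> good n}"
      by (metis (no_types, lifting) card_Un_disjoint disjoint_iff finite_Un
          finite_atLeastAtMost finite_perfect_matchings mem_Collect_eq)
    then have "real (odd_fact n) =
        real (card {M \<in> ?P. M \<in> good n}) + real (card {M \<in> ?P. M \<notin> good n})"
      by (simp add: card_perfect_matchings)
    then have "(1 - err n) * odd_fact n \<le> card {M \<in> ?P. M \<in> good n}"
      using bad by (simp add: algebra_simps)
    then show ?thesis
      unfolding prob_RM using odd_fact_pos[of n] by (simp add: pos_le_divide_eq)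
  qed
  have "(\<lambda>n. measure_pmf.prob (RM n) (good n)) \<longlonglongrightarrow> 1"
    using err0
  proof (rule tendsto_sandwich[rotated 2])
    show "eventually (\<lambda>n. 1 - err n \<le> measure_pmf.prob (RM n) (good n)) sequentially"
      using bound by (rule eventually_sequentiallyI)
    show "eventually (\<lambda>n. measure_pmf.prob (RM n) (good n) \<le> 1) sequentially"
      by simp
  qed simp
  then show ?thesis
    using \<open>\<epsilon> \<longlonglongrightarrow> 0\<close> unfolding good_def q_def by blast
qed

end
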